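(* Let $G$ be a non-locally compact Polish group admitting a (compatible) two-sided invariant metric. Then \[ \mathrm{cof}(\mathcal{HN}(G))=\mathrm{cof}(\mathcal{HM}(G))=\mathfrak{c}. \]
   Context: A subset $X$ of a Polish group $G$ is Haar null if there exist a Borel probability measure $\mu$ on $G$ and a Borel set $B\subset G$ containing $X$ such that $\mu(gBh)=0$ for every $g,h\in G$; $\mathcal{HN}(G)$ is the family of Haar null subsets of $G$. A subset $X$ of $G$ is Haar meager if there exist a (non-empty) compact metric space $K$, a continuous function $f:K\to G$ and a Borel set $B\subset G$ containing $X$ such that $f^{-1}(gBh)$ is meager in $K$ for every $g,h\in G$; $\mathcal{HM}(G)$ is the family of Haar meager subsets of $G$. Both families are proper $\sigma$-ideals. A metric $d$ on $G$ is two-sided invariant if $d(x,y)=d(zx,zy)=d(xz,yz)$ for all $x,y,z\in G$. For a $\sigma$-ideal $\mathcal{I}$, $\mathrm{cof}(\mathcal{I})=\min\{|\mathcal{A}|:\mathcal{A}\subset\mathcal{I},\ \forall I\in\mathcal{I}\ \exists A\in\mathcal{A}\ I\subset A\}$. $\mathfrak{c}=2^{\aleph_0}$. *)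

theory Defs
  imports "HOL-Analysis.Analysis"
begin

unbundle cardinal_syntax

section \<open>Haar null sets\<close>

text \<open>
  A Polish group is a type of the classes \<open>polish_space\<close> and \<open>topological_group_add\<close>. The class
  \<open>group_add\<close> does not include commutativity, so the product \<open>g x h\<close> of a (possibly non-abelian)
  group is written \<open>g + x + h\<close>. The complete metric \<open>dist\<close> that comes with \<open>polish_space\<close> is not
  assumed to be invariant; only its topology is used.
\<close>

definition two_sided_translate :: "'a::group_add \<Rightarrow> 'a set \<Rightarrow> 'a \<Rightarrow> 'a set" where
  "two_sided_translate g B h = (\<lambda>x. g + x + h) ` B"

text \<open>
  Translates of Borel sets are Borel, so the value \<open>0\<close> that \<open>emeasure\<close> gives to non-measurable sets
  plays no role in \<open>haar_null\<close>.
\<close>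

lemma two_sided_translate_borel:
  fixes B :: "'a::topological_group_add set"
  assumes "B \<in> sets borel"
  shows "two_sided_translate g B h \<in> sets borel"
proof -
  have eq: "two_sided_translate g B h = (\<lambda>y. - g + (y - h)) -` B \<inter> space borel"
  proof (intro subset_antisym subsetI)
    fix y assume "y \<in> two_sided_translate g B h"
    then obtain x where "x \<in> B" "y = g + x + h"
      unfolding two_sided_translate_def by blast
    moreover have "- g + (g + x + h - h) = x"
      by (simp only: add_diff_cancel minus_add_cancel)
    ultimately show "y \<in> (\<lambda>y. - g + (y - h)) -` B \<inter> space borel"
      by simp
  next
    fix y assume "y \<in> (\<lambda>y. - g + (y - h)) -` B \<inter> space borel"
    moreover have "g + (- g + (y - h)) + h = y"
      by (simp add: add.assoc[symmetric])
    ultimately show "y \<in> two_sided_translate g B h"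
      unfolding two_sided_translate_def by (metis IntD1 image_eqI vimageD)
  qed
  have "continuous_on UNIV (\<lambda>y. - g + (y - h))"
    by (intro continuous_intros)
  then have "(\<lambda>y. - g + (y - h)) \<in> borel_measurable borel"
    by (rule borel_measurable_continuous_onI)
  then show ?thesis
    unfolding eq using assms by (rule measurable_sets)
qed

definition haar_null :: "'a::{polish_space,topological_group_add} set \<Rightarrow> bool" where
  "haar_null X \<longleftrightarrow>
    (\<exists>\<mu> :: 'a measure. \<exists>B \<in> sets borel.
       sets \<mu> = sets borel \<and> emeasure \<mu> (space \<mu>) = 1 \<and> X \<subseteq> B \<and>
       (\<forall>g h. emeasure \<mu> (two_sided_translate g B h) = 0))"

section \<open>Haar meager sets\<close>

definition nowhere_dense_in :: "'b topology \<Rightarrow> 'b set \<Rightarrow> bool" where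
  "nowhere_dense_in T N \<longleftrightarrow> N \<subseteq> topspace T \<and> T interior_of (T closure_of N) = {}"

definition meager_in :: "'b topology \<Rightarrow> 'b set \<Rightarrow> bool" where
  "meager_in T A \<longleftrightarrow> (\<exists>\<N>. countable \<N> \<and> (\<forall>N\<in>\<N>. nowhere_dense_in T N) \<and> A = \<Union>\<N>)"

definition haar_meager_witness ::
    "'b set \<Rightarrow> ('b \<Rightarrow> 'b \<Rightarrow> real) \<Rightarrow> ('b \<Rightarrow> 'a) \<Rightarrow> 'a set
      \<Rightarrow> 'a::{polish_space,topological_group_add} set \<Rightarrow> bool" where
  "haar_meager_witness K d f B X \<longleftrightarrow>
    Metric_space K d \<and> K \<noteq> {} \<and> compact_space (Metric_space.mtopology K d) \<and>
    continuous_map (Metric_space.mtopology K d) euclidean f \<and>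
    B \<in> sets borel \<and> X \<subseteq> B \<and>
    (\<forall>g h. meager_in (Metric_space.mtopology K d) {x \<in> K. f x \<in> two_sided_translate g B h})"

text \<open>
  The points of \<open>K\<close> are taken from the type \<open>real\<close>, but \<open>d\<close> is an arbitrary metric on \<open>K\<close>, unrelated
  to the metric of the reals. A compact metric space has at most continuum many points, so up to
  isometry all compact metric spaces occur; see \<open>haar_meagerI\<close> below.
\<close>

definition haar_meager :: "'a::{polish_space,topological_group_add} set \<Rightarrow> bool" where
  "haar_meager X \<longleftrightarrow> (\<exists>(K :: real set) d f B. haar_meager_witness K d f B X)"

lemma compact_metric_lepoll_real:
  assumes "Metric_space K d" "compact_space (Metric_space.mtopology K d)"
  shows "K \<lesssim> (UNIV :: real set)"
proof -
  interpret Metric_space K d by fact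
  have "mtotally_bounded K"
    using assms(2) compact_space_eq_mcomplete_mtotally_bounded by blast
  then have "\<exists>F. finite F \<and> F \<subseteq> K \<and> K \<subseteq> (\<Union>x\<in>F. mball x (1 / real (Suc n)))" for n
    unfolding mtotally_bounded_def by (elim allE[of _ "1 / real (Suc n)"]) simp
  then obtain F where F: "\<And>n. finite (F n)" "\<And>n. F n \<subseteq> K"
      "\<And>n. K \<subseteq> (\<Union>x\<in>F n. mball x (1 / real (Suc n)))"
    by metis
  define S where "S = (\<Union>n. F n)"
  have "countable S"
    unfolding S_def using F(1) by (simp add: countable_finite)
  define \<phi> where "\<phi> x = {(n, to_nat_on S s) |n s. s \<in> S \<and> x \<in> mball s (1 / real (Suc n))}" for x
  have "inj_on \<phi> K"
  proof (rule inj_onI, rule ccontr)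
    fix x y assume xy: "x \<in> K" "y \<in> K" "\<phi> x = \<phi> y" "x \<noteq> y"
    then have "d x y > 0" by simp
    then obtain n where n: "1 / real (Suc n) < d x y / 2"
      using nat_approx_posE[of "d x y / 2"] by auto
    obtain s where s: "s \<in> F n" "x \<in> mball s (1 / real (Suc n))"
      using F(3)[of n] xy(1) by auto
    then have "s \<in> S" by (auto simp: S_def)
    then have "(n, to_nat_on S s) \<in> \<phi> x"
      unfolding \<phi>_def mem_Collect_eq using s(2) by (intro exI[of _ n] exI[of _ s] conjI refl)
    then have "(n, to_nat_on S s) \<in> \<phi> y"
      by (simp only: xy(3))
    then obtain s' where s': "to_nat_on S s = to_nat_on S s'" "s' \<in> S" "y \<in> mball s' (1 / real (Suc n))"
      unfolding \<phi>_def mem_Collect_eq prod.inject by (elim exE conjE) (rule that, simp_all only:)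
    then have "s' = s"
      using to_nat_on_inj[OF \<open>countable S\<close> \<open>s \<in> S\<close> s'(2)] by simp
    then have "s \<in> K" "d s y < 1 / real (Suc n)" "d s x < 1 / real (Suc n)"
      using s'(3) s(2) by (simp_all only: in_mball)
    then show False
      using n triangle[OF xy(1) \<open>s \<in> K\<close> xy(2)] commute[of x s] by linarith
  qed
  then have "K \<lesssim> (UNIV :: (nat \<times> nat) set set)"
    unfolding lepoll_def by blast
  also have "(UNIV :: (nat \<times> nat) set set) \<lesssim> (UNIV :: nat set set)"
    unfolding lepoll_def
    by (rule exI[of _ "\<lambda>A. prod_encode ` A"]) (auto simp: inj_on_def inj_image_eq_iff[OF inj_prod_encode])
  also have "(UNIV :: nat set set) \<lesssim> (UNIV :: real set)"
    using nat_sets_eqpoll_reals eqpoll_imp_lepoll by blast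
  finally show ?thesis .
qed

lemma haar_meagerI:
  fixes K :: "'b set"
  assumes "haar_meager_witness K d f B X"
  shows "haar_meager X"
proof -
  note W = assms[unfolded haar_meager_witness_def]
  obtain \<phi> :: "'b \<Rightarrow> real" where inj: "inj_on \<phi> K"
    using compact_metric_lepoll_real W unfolding lepoll_def by blast
  define \<psi> where "\<psi> = inv_into K \<phi>"
  define e where "e a b = d (\<psi> a) (\<psi> b)" for a b
  have \<psi>\<phi> [simp]: "\<psi> (\<phi> x) = x" if "x \<in> K" for x
    using that inj by (simp add: \<psi>_def)
  interpret M1: Metric_space K d using W by blast
  interpret M2: Metric_space "\<phi> ` K" e
    by (rule Metric_space.intro) (auto simp: e_def M1.commute M1.triangle)
  interpret M12: Metric_space12 K d "\<phi> ` K" e ..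
  have hom: "homeomorphic_map M1.mtopology M2.mtopology \<phi>"
    by (rule M12.isometry_imp_homeomorphic_map) (auto simp: e_def)
  have inv: "continuous_map M2.mtopology M1.mtopology \<psi>"
  proof -
    obtain g where g: "continuous_map M2.mtopology M1.mtopology g" "\<And>x. x \<in> K \<Longrightarrow> g (\<phi> x) = x"
      using hom unfolding homeomorphic_map_maps homeomorphic_maps_def by auto
    show ?thesis
      by (rule continuous_map_eq[OF g(1)]) (use g(2) in auto)
  qed
  have meager: "meager_in M2.mtopology (\<phi> ` A)" if A: "meager_in M1.mtopology A" for A
  proof -
    obtain \<N> where \<N>: "countable \<N>" "\<forall>N\<in>\<N>. nowhere_dense_in M1.mtopology N" "A = \<Union>\<N>"
      using A unfolding meager_in_def by blast
    have "nowhere_dense_in M2.mtopology (\<phi> ` N)" if "N \<in> \<N>" for N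
    proof -
      have N: "N \<subseteq> K" "M1.mtopology interior_of (M1.mtopology closure_of N) = {}"
        using bspec[OF \<N>(2) that] unfolding nowhere_dense_in_def M1.topspace_mtopology by simp_all
      have "M2.mtopology interior_of (M2.mtopology closure_of (\<phi> ` N))
          = \<phi> ` (M1.mtopology interior_of (M1.mtopology closure_of N))"
        using homeomorphic_map_closure_of[OF hom, of N] N(1)
          homeomorphic_map_interior_of[OF hom closure_of_subset_topspace]
        by (simp only: M1.topspace_mtopology)
      then show ?thesis
        unfolding nowhere_dense_in_def M2.topspace_mtopology N(2) using image_mono[OF N(1)] by simp
    qed
    then have "\<forall>N \<in> (`) \<phi> ` \<N>. nowhere_dense_in M2.mtopology N"
      by blast
    moreover have "countable ((`) \<phi> ` \<N>)"
      using \<N>(1) by (rule countable_image)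
    moreover have "\<phi> ` A = \<Union> ((`) \<phi> ` \<N>)"
      unfolding \<N>(3) by (rule image_Union)
    ultimately show ?thesis
      unfolding meager_in_def by blast
  qed
  have "haar_meager_witness (\<phi> ` K) e (f \<circ> \<psi>) B X"
    unfolding haar_meager_witness_def
  proof (intro conjI allI)
    show "Metric_space (\<phi> ` K) e" by (rule M2.Metric_space_axioms)
    show "\<phi> ` K \<noteq> {}" using W by blast
    show "compact_space M2.mtopology"
      using W hom by (meson homeomorphic_compact_space homeomorphic_map_imp_homeomorphic_space)
    show "continuous_map M2.mtopology euclidean (f \<circ> \<psi>)"
      using W inv continuous_map_compose by blast
    show "B \<in> sets borel" "X \<subseteq> B" using W by auto
    fix g h
    have "{x \<in> \<phi> ` K. (f \<circ> \<psi>) x \<in> two_sided_translate g B h}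
        = \<phi> ` {x \<in> K. f x \<in> two_sided_translate g B h}"
      by auto
    then show "meager_in M2.mtopology {x \<in> \<phi> ` K. (f \<circ> \<psi>) x \<in> two_sided_translate g B h}"
      using meager W by (simp only:)
  qed
  then show ?thesis
    unfolding haar_meager_def by blast
qed

section \<open>Cofinality of a family of sets\<close>

definition cofinal_subfamily :: "'b set set \<Rightarrow> 'b set set \<Rightarrow> bool" where
  "cofinal_subfamily \<I> \<A> \<longleftrightarrow> \<A> \<subseteq> \<I> \<and> (\<forall>I\<in>\<I>. \<exists>A\<in>\<A>. I \<subseteq> A)"

text \<open>
  Cardinals are cardinal orders, compared by \<open>\<le>o\<close> and \<open>=o\<close>; the least one is determined up to \<open>=o\<close>.
\<close>

definition cof :: "'b set set \<Rightarrow> 'b set rel" where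
  "cof \<I> = (SOME \<kappa>. \<kappa> \<in> {|\<A>| | \<A>. cofinal_subfamily \<I> \<A>} \<and>
                  (\<forall>\<kappa>' \<in> {|\<A>| | \<A>. cofinal_subfamily \<I> \<A>}. \<kappa> \<le>o \<kappa>'))"

lemma cof_minimum:
  "cof \<I> \<in> {|\<A>| | \<A>. cofinal_subfamily \<I> \<A>} \<and>
    (\<forall>\<kappa>' \<in> {|\<A>| | \<A>. cofinal_subfamily \<I> \<A>}. cof \<I> \<le>o \<kappa>')"
proof -
  let ?R = "{|\<A>| | \<A>. cofinal_subfamily \<I> \<A>}"
  have "cofinal_subfamily \<I> \<I>"
    by (auto simp: cofinal_subfamily_def)
  then have "?R \<noteq> {}" by blast
  moreover have "\<forall>r\<in>?R. Card_order r" using card_of_Card_order by blast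
  ultimately have "\<exists>\<kappa>. \<kappa> \<in> ?R \<and> (\<forall>\<kappa>'\<in>?R. \<kappa> \<le>o \<kappa>')"
    using exists_minim_Card_order[of ?R] by blast
  then show ?thesis
    unfolding cof_def by (rule someI_ex)
qed

section \<open>Two-sided invariant metrics\<close>

definition admits_two_sided_invariant_metric :: "'a::{topological_space,group_add} itself \<Rightarrow> bool" where
  "admits_two_sided_invariant_metric _ \<longleftrightarrow>
    (\<exists>d :: 'a \<Rightarrow> 'a \<Rightarrow> real.
       Metric_space UNIV d \<and> Metric_space.mtopology UNIV d = euclidean \<and>
       (\<forall>x y z. d x y = d (z + x) (z + y) \<and> d x y = d (x + z) (y + z)))"

end

theory Submission
  imports Defs "HOL-Library.Countable_Set_Type"
begin

text \<open>
  The upper bound holds because there are only continuum many Borel sets. For the lower bound,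
  attach to every \<open>\<alpha> :: nat \<Rightarrow> bool\<close> the closed set \<open>piece \<alpha>\<close> of all points \<open>shift z + x\<close>, where \<open>z\<close> ranges
  over the codes of partial continuous functions from the Cantor space to the group, \<open>x\<close> is the value
  at \<open>\<alpha>\<close> of the function coded by \<open>z\<close>, and \<open>shift\<close> spreads out the codes so far that the distance of
  two points of \<open>piece \<alpha>\<close> is never the distance of two points of a fixed Cantor set. By invariance of
  the metric, every translate of \<open>piece \<alpha>\<close> meets that Cantor set in at most one point, so \<open>piece \<alpha>\<close> is
  Haar null and Haar meager. If a Borel set \<open>B\<close> contains \<open>piece \<alpha>\<close> for more than \<open>\<aleph>\<^sub>1\<close> many \<open>\<alpha>\<close>, then these
  \<open>\<alpha>\<close> form a coanalytic set, which therefore has a perfect subset (Mansfield), and every compact set \<open>C\<close> is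
  the range of a coded function on it; hence \<open>B\<close> contains a translate of every compact set and is neither
  Haar null nor Haar meager. So a cofinal family \<open>\<A>\<close> satisfies \<open>\<cc> \<le> |\<A>| \<cdot> \<aleph>\<^sub>1\<close>. This suffices unless
  \<open>\<cc> = \<aleph>\<^sub>1\<close>, and then it is enough that \<open>\<A>\<close> is uncountable, which holds because countable sets are small.
\<close>

section \<open>Perfect subsets of projections of trees\<close>

definition finitely_closed :: "(nat \<Rightarrow> 'b) set \<Rightarrow> bool" where
  "finitely_closed Y \<longleftrightarrow> (\<forall>y. (\<forall>n. \<exists>y'\<in>Y. \<forall>i<n. y' i = y i) \<longrightarrow> y \<in> Y)"

lemma finitely_closedD:
  "finitely_closed Y \<Longrightarrow> (\<And>n. \<exists>y'\<in>Y. \<forall>i<n. y' i = y i) \<Longrightarrow> y \<in> Y"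
  unfolding finitely_closed_def by blast

lemma finite_ordLeq_Cinfinite: "finite A \<Longrightarrow> Cinfinite r \<Longrightarrow> |A| \<le>o r"
  by (metis Cfinite_ordLess_Cinfinite Field_card_of card_of_Card_order cfinite_def ordLess_imp_ordLeq)

lemma card_of_lists_bound:
  assumes r: "Cinfinite r" and A: "|A| \<le>o r"
  shows "|lists A| \<le>o r"
proof -
  have "|{xs \<in> lists A. length xs = n}| \<le>o r" for n
  proof (induction n)
    case 0
    have "{xs \<in> lists A. length xs = 0} = {[]}" by auto
    then show ?case by (simp only: finite_ordLeq_Cinfinite[OF _ r] finite.intros)
  next
    case (Suc n)
    have "{xs \<in> lists A. length xs = Suc n} = (\<Union>a\<in>A. (#) a ` {xs \<in> lists A. length xs = n})"
      by (auto simp: length_Suc_conv image_iff)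
    moreover have "\<forall>a\<in>A. |(#) a ` {xs \<in> lists A. length xs = n}| \<le>o r"
      using Suc ordLeq_transitive[OF card_of_image] by blast
    ultimately show ?case
      using UNION_Cinfinite_bound[OF A _ r] by (simp only:)
  qed
  then have "|\<Union>n\<in>UNIV. {xs \<in> lists A. length xs = n}| \<le>o r"
    using r by (intro UNION_Cinfinite_bound ballI) (auto intro: ordIso_ordLeq_trans[OF card_of_nat natLeq_ordLeq_cinfinite])
  moreover have "lists A = (\<Union>n\<in>UNIV. {xs \<in> lists A. length xs = n})" by auto
  ultimately show ?thesis by simp
qed

text \<open>The one-step form of Mansfield's derivative: remove from \<open>Y\<close> the branches through nodes above
  which the projection has at most \<open>r\<close> elements.\<close>

lemma splitting_subset:
  fixes Y :: "(nat \<Rightarrow> bool \<times> 'w) set"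
  assumes r: "Cinfinite r" and W: "|W| \<le>o r" and YW: "\<forall>y\<in>Y. \<forall>n. snd (y n) \<in> W"
    and large: "\<not> |(\<lambda>y. fst \<circ> y) ` Y| \<le>o r"
  obtains Y' where "Y' \<subseteq> Y" "Y' \<noteq> {}"
    "\<And>y n. y \<in> Y' \<Longrightarrow> infinite ((\<lambda>y. fst \<circ> y) ` {y'\<in>Y'. \<forall>i<n. y' i = y i})"
proof -
  define \<pi> :: "(nat \<Rightarrow> bool \<times> 'w) \<Rightarrow> nat \<Rightarrow> bool" where "\<pi> = (\<lambda>y. fst \<circ> y)"
  define E where "E t = {y\<in>Y. map y [0..<length t] = t}" for t
  define T where "T = {t \<in> lists (UNIV \<times> W). |\<pi> ` E t| \<le>o r}"
  define S where "S = (\<Union>t\<in>T. \<pi> ` E t)"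
  define Y' where "Y' = {y\<in>Y. \<forall>n. map y [0..<n] \<notin> T}"
  have "|UNIV :: bool set| \<le>o r"
    using r by (intro finite_ordLeq_Cinfinite) auto
  then have "|(UNIV :: bool set) \<times> W| \<le>o r"
    using W r card_of_Times_ordLeq_infinite_Field[of r] unfolding cinfinite_def by blast
  then have "|lists ((UNIV :: bool set) \<times> W)| \<le>o r"
    using r by (rule card_of_lists_bound[rotated])
  then have "|T| \<le>o r"
    by (rule ordLeq_transitive[OF card_of_mono1, rotated]) (auto simp: T_def)
  then have S: "|S| \<le>o r"
    unfolding S_def using r by (intro UNION_Cinfinite_bound) (auto simp: T_def)
  have cover: "\<pi> ` E t \<subseteq> S \<union> \<pi> ` {y\<in>Y'. map y [0..<length t] = t}" for t
  proof
    fix a assume "a \<in> \<pi> ` E t"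
    then obtain y where y: "y \<in> Y" "map y [0..<length t] = t" "a = \<pi> y"
      by (auto simp: E_def)
    show "a \<in> S \<union> \<pi> ` {y\<in>Y'. map y [0..<length t] = t}"
    proof (cases "y \<in> Y'")
      case False
      then obtain n where "map y [0..<n] \<in> T" using y(1) by (auto simp: Y'_def)
      moreover have "y \<in> E (map y [0..<n])" using y(1) by (simp add: E_def)
      ultimately show ?thesis using y(3) by (auto simp: S_def)
    qed (use y in auto)
  qed
  have "Y' \<noteq> {}"
  proof
    assume "Y' = {}"
    then have "\<pi> ` Y \<subseteq> S" using cover[of "[]"] by (simp add: E_def)
    then have "|\<pi> ` Y| \<le>o r" using S card_of_mono1 ordLeq_transitive by blast
    then show False using large by (simp add: \<pi>_def)
  qed
  moreover have "infinite (\<pi> ` {y'\<in>Y'. \<forall>i<n. y' i = y i})" if y: "y \<in> Y'" for y n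
  proof
    assume fin: "finite (\<pi> ` {y'\<in>Y'. \<forall>i<n. y' i = y i})"
    \<comment> \<open>If only finitely many projections survived above this node, then the node
      would have at most \<open>r\<close> projections in all, the lost ones lying in
      \<open>S\<close>. It would then belong to \<open>T\<close>, which no branch in
      \<open>Y'\<close> meets.\<close>
    let ?t = "map y [0..<n]"
    have "{y'\<in>Y'. \<forall>i<n. y' i = y i} = {y'\<in>Y'. map y' [0..<length ?t] = ?t}" by auto
    then have "|\<pi> ` {y'\<in>Y'. map y' [0..<length ?t] = ?t}| \<le>o r"
      using fin r finite_ordLeq_Cinfinite by (metis (no_types, lifting))
    then have "|\<pi> ` E ?t| \<le>o r"
      using cover[of ?t] S r by (meson Un_Cinfinite_bound card_of_mono1 ordLeq_transitive)
    moreover have "?t \<in> lists (UNIV \<times> W)"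
      unfolding in_lists_conv_set using y YW by (simp add: Y'_def mem_Times_iff)
    ultimately have "?t \<in> T" by (simp add: T_def)
    then show False using y by (auto simp: Y'_def)
  qed
  ultimately show thesis
    using that[of Y'] by (auto simp: Y'_def \<pi>_def)
qed

text \<open>A table \<open>(m, l)\<close> describes a function on part of the Cantor space whose value depends only on the
  first \<open>m\<close> bits of the argument: \<open>l\<close> associates bit strings of length \<open>m\<close> with values.\<close>

type_synonym table = "nat \<times> (bool list \<times> nat) list"

definition table_val :: "table \<Rightarrow> (nat \<Rightarrow> bool) \<Rightarrow> nat option" where
  "table_val \<tau> \<alpha> = map_of (snd \<tau>) (map \<alpha> [0..<fst \<tau>])"

lemma table_val_cong: "(\<And>i. i < fst \<tau> \<Longrightarrow> \<alpha> i = \<beta> i) \<Longrightarrow> table_val \<tau> \<alpha> = table_val \<tau> \<beta>"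
  unfolding table_val_def by (auto intro!: arg_cong[where f = "map_of (snd \<tau>)"])

lemma table_val_range: "table_val \<tau> \<alpha> = Some i \<Longrightarrow> i \<in> snd ` set (snd \<tau>)"
  unfolding table_val_def by (force dest: map_of_SomeD)

lemma finite_separating_length:
  fixes f :: "'u \<Rightarrow> nat \<Rightarrow> 'b"
  assumes "finite A" "inj_on f A"
  shows "\<exists>m\<ge>k. inj_on (\<lambda>u. map (f u) [0..<m]) A"
proof -
  have "\<exists>m. \<forall>u\<in>A. \<forall>v\<in>A. u \<noteq> v \<longrightarrow> (\<exists>j<m. f u j \<noteq> f v j)"
  proof -
    have "\<forall>p\<in>A\<times>A. \<exists>j. fst p \<noteq> snd p \<longrightarrow> f (fst p) j \<noteq> f (snd p) j"
      using assms(2) by (metis inj_onD mem_Times_iff ext)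
    then obtain J where J: "\<And>p. p \<in> A\<times>A \<Longrightarrow> fst p \<noteq> snd p \<Longrightarrow> f (fst p) (J p) \<noteq> f (snd p) (J p)"
      by metis
    have "finite (J ` (A\<times>A))" using assms(1) by simp
    then obtain m where "\<And>p. p \<in> A\<times>A \<Longrightarrow> J p < m"
      by (metis finite_nat_set_iff_bounded imageI)
    then show ?thesis using J by (intro exI[of _ m]) force
  qed
  then obtain m where m: "\<And>u v. u\<in>A \<Longrightarrow> v\<in>A \<Longrightarrow> u \<noteq> v \<Longrightarrow> \<exists>j<m. f u j \<noteq> f v j" by blast
  have "inj_on (\<lambda>u. map (f u) [0..<max m k]) A"
  proof (rule inj_onI)
    fix u v assume uv: "u \<in> A" "v \<in> A" "map (f u) [0..<max m k] = map (f v) [0..<max m k]"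
    then have "f u j = f v j" if "j < m" for j
      using that by (metis (no_types, lifting) add_0 atLeast_upt lessThan_iff map_eq_conv max.strict_coboundedI1)
    then show "u = v" using m uv by blast
  qed
  then show ?thesis by (intro exI[of _ "max m k"]) auto
qed

text \<open>A fusion along the tree of finite sequences \<open>u\<close> with \<open>u ! i\<close>
  in \<open>N i\<close>. Each node gets a branch of \<open>Y'\<close>, and its successors get
  branches that keep the part fixed so far but have different projections. Hence finitely many bits
  of the projection determine \<open>u\<close>, and a table can read off its last entry. The limit
  along \<open>c\<close> lies in \<open>Y\<close> because \<open>Y\<close> is closed. One sequence
  of tables serves all \<open>c\<close>.\<close>

lemma perfect_table:
  fixes Y :: "(nat \<Rightarrow> bool \<times> 'w) set" and N :: "nat \<Rightarrow> nat set"
  assumes r: "Cinfinite r" and W: "|W| \<le>o r" and YW: "\<forall>y\<in>Y. \<forall>n. snd (y n) \<in> W"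
    and large: "\<not> |(\<lambda>y. fst \<circ> y) ` Y| \<le>o r"
    and closed: "finitely_closed Y" and N: "\<And>n. finite (N n)"
  shows "\<exists>\<tau>. \<forall>c. (\<forall>n. c n \<in> N n) \<longrightarrow>
    (\<exists>y\<in>Y. \<forall>n. table_val (\<tau> n) (fst \<circ> y) = Some (c n))"
proof -
  obtain Y' where Y': "Y' \<subseteq> Y" "Y' \<noteq> {}"
    and split: "\<And>y n. y \<in> Y' \<Longrightarrow> infinite ((\<lambda>y. fst \<circ> y) ` {y'\<in>Y'. \<forall>i<n. y' i = y i})"
    using splitting_subset[of r W Y, OF r W YW large] by blast
  define L where "L n = {u :: nat list. length u = n \<and> (\<forall>i<n. u ! i \<in> N i)}" for n
  have L_Suc: "L (Suc n) = (\<lambda>(u, i). u @ [i]) ` (L n \<times> N n)" for n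
  proof (intro subset_antisym subsetI)
    fix v assume v: "v \<in> L (Suc n)"
    then have "v \<noteq> []" "length v = Suc n" by (auto simp: L_def)
    then have eq: "v = butlast v @ [last v]" and "length (butlast v) = n" "last v = v ! n"
      by (simp, simp, simp add: last_conv_nth)
    then have "butlast v \<in> L n" "last v \<in> N n"
      using v by (auto simp: L_def nth_butlast)
    then show "v \<in> (\<lambda>(u, i). u @ [i]) ` (L n \<times> N n)" using eq by force
  qed (auto simp: L_def nth_append less_Suc_eq)
  have fin: "finite (L n)" for n
    by (induction n) (use N in \<open>auto simp: L_Suc, simp add: L_def\<close>)
  \<comment> \<open>A state consists of a branch for each node and the number of positions already
    fixed; \<open>n \<le> snd s\<close> makes every position fixed in the end.\<close>
  define P where "P n s \<longleftrightarrow> n \<le> snd s \<and> (\<forall>u\<in>L n. fst s u \<in> Y') \<and>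
      inj_on (\<lambda>u. map (fst \<circ> fst s u) [0..<snd s]) (L n)"
    for n and s :: "(nat list \<Rightarrow> nat \<Rightarrow> bool \<times> 'w) \<times> nat"
  define Q where "Q n s s' \<longleftrightarrow> snd s \<le> snd s' \<and>
      (\<forall>u\<in>L n. \<forall>i\<in>N n. \<forall>j<snd s. fst s' (u @ [i]) j = fst s u j)"
    for n and s s' :: "(nat list \<Rightarrow> nat \<Rightarrow> bool \<times> 'w) \<times> nat"
  have "\<exists>s. \<forall>n. P n (s n) \<and> Q n (s n) (s (Suc n))"
  proof (rule dependent_nat_choice)
    obtain y where "y \<in> Y'" using Y' by blast
    then have "P 0 (\<lambda>_. y, 0)" by (auto simp: P_def L_def)
    then show "\<exists>s. P 0 s" ..
  next
    fix s n assume s: "P n s"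
    \<comment> \<open>Infinite splitting above the fixed part supplies a distinct projection for
      every possible successor of \<open>u\<close>.\<close>
    have "\<exists>e :: nat \<Rightarrow> nat \<Rightarrow> bool. inj e \<and> range e \<subseteq> (\<lambda>y. fst \<circ> y) ` {y'\<in>Y'. \<forall>i<snd s. y' i = fst s u i}"
      if "u \<in> L n" for u
      using infinite_countable_subset[OF split[of "fst s u" "snd s"]] s that by (auto simp: P_def)
    then have "\<forall>u. \<exists>e :: nat \<Rightarrow> nat \<Rightarrow> bool. u \<in> L n \<longrightarrow>
        inj e \<and> range e \<subseteq> (\<lambda>y. fst \<circ> y) ` {y'\<in>Y'. \<forall>i<snd s. y' i = fst s u i}"
      by blast
    from this[unfolded choice_iff] obtain e :: "nat list \<Rightarrow> nat \<Rightarrow> nat \<Rightarrow> bool" where e: "\<And>u. u \<in> L n \<Longrightarrow> inj (e u)"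
      "\<And>u. u \<in> L n \<Longrightarrow> range (e u) \<subseteq> (\<lambda>y. fst \<circ> y) ` {y'\<in>Y'. \<forall>i<snd s. y' i = fst s u i}"
      by blast
    have "\<exists>y. y \<in> Y' \<and> (\<forall>j<snd s. y j = fst s u j) \<and> fst \<circ> y = e u i" if "u \<in> L n" for u i
    proof -
      have "e u i \<in> (\<lambda>y. fst \<circ> y) ` {y'\<in>Y'. \<forall>i<snd s. y' i = fst s u i}"
        using e(2)[OF that] by blast
      then show ?thesis by (elim imageE) (simp, metis)
    qed
    then have "\<forall>u i. \<exists>y. u \<in> L n \<longrightarrow> y \<in> Y' \<and> (\<forall>j<snd s. y j = fst s u j) \<and> fst \<circ> y = e u i"
      by blast
    from this[unfolded choice_iff] obtain h where h: "\<And>u i. u \<in> L n \<Longrightarrow> h u i \<in> Y'"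
      "\<And>u i j. u \<in> L n \<Longrightarrow> j < snd s \<Longrightarrow> h u i j = fst s u j"
      "\<And>u i. u \<in> L n \<Longrightarrow> fst \<circ> h u i = e u i"
      by blast
    define f where "f v = h (butlast v) (last v)" for v
    have f: "f (u @ [i]) = h u i" for u i by (simp add: f_def)
    have "inj_on (\<lambda>v. fst \<circ> f v) (L (Suc n))"
    proof (rule inj_onI)
      fix v v' assume "v \<in> L (Suc n)" "v' \<in> L (Suc n)" and eq: "fst \<circ> f v = fst \<circ> f v'"
      then obtain u i u' i' where v: "v = u @ [i]" "v' = u' @ [i']" "u \<in> L n" "u' \<in> L n"
        by (auto simp: L_Suc)
      have "map (fst \<circ> fst s u) [0..<snd s] = map (fst \<circ> f v) [0..<snd s]"
        using h(2)[OF v(3)] by (simp add: v f)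
      also have "\<dots> = map (fst \<circ> f v') [0..<snd s]" by (simp only: eq)
      also have "\<dots> = map (fst \<circ> fst s u') [0..<snd s]"
        using h(2)[OF v(4)] by (simp add: v f)
      finally have "u = u'" using s v by (auto simp: P_def dest: inj_onD)
      then have "e u i = e u i'" using eq h(3) v by (simp add: f)
      then show "v = v'" using e(1)[OF v(3)] \<open>u = u'\<close> v by (simp add: inj_eq)
    qed
    then obtain m where m: "m \<ge> max (Suc n) (snd s)" "inj_on (\<lambda>v. map (fst \<circ> f v) [0..<m]) (L (Suc n))"
      using finite_separating_length[OF fin] by blast
    have "P (Suc n) (f, m)" "Q n s (f, m)"
      using m h by (auto simp: P_def Q_def L_Suc f)
    then show "\<exists>s'. P (Suc n) s' \<and> Q n s s'" by blast
  qed
  then obtain s where sP: "\<And>n. P n (s n)" and sQ: "\<And>n. Q n (s n) (s (Suc n))" by blast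
  define f where "f n = fst (s n)" for n
  define m where "m n = snd (s n)" for n
  have m: "n \<le> m n" and fY: "u \<in> L n \<Longrightarrow> f n u \<in> Y'"
    and inj: "inj_on (\<lambda>u. map (fst \<circ> f n u) [0..<m n]) (L n)" for n u
    using sP[of n] by (auto simp: P_def f_def m_def)
  have mS: "m n \<le> m (Suc n)"
    and ext: "u \<in> L n \<Longrightarrow> i \<in> N n \<Longrightarrow> j < m n \<Longrightarrow> f (Suc n) (u @ [i]) j = f n u j" for n u i j
    using sQ[of n] by (auto simp: Q_def f_def m_def)
  have "\<forall>n. \<exists>l. set l = L n" using fin finite_list by blast
  then obtain l where l: "\<And>n. set (l n) = L n" by metis
  \<comment> \<open>The entry \<open>c n\<close> is the last one of the node at level
    \<open>Suc n\<close>, so table \<open>n\<close> uses that level.\<close>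
  define \<tau> where "\<tau> n = (m (Suc n), map (\<lambda>u. (map (fst \<circ> f (Suc n) u) [0..<m (Suc n)], last u)) (l (Suc n)))" for n
  have "\<exists>y\<in>Y. \<forall>n. table_val (\<tau> n) (fst \<circ> y) = Some (c n)" if c: "\<forall>n. c n \<in> N n" for c
  proof -
    define u where "u n = map c [0..<n]" for n
    have uL: "u n \<in> L n" for n using c by (simp add: L_def u_def)
    have step: "f (Suc n) (u (Suc n)) j = f n (u n) j" if "j < m n" for n j
      using ext[OF uL, of "c n"] c that by (simp add: u_def)
    have stable: "f (n + k) (u (n + k)) j = f n (u n) j" if "j < m n" for n k j
    proof (induction k)
      case (Suc k)
      have "m n \<le> m (n + k)" using lift_Suc_mono_le[of m n "n+k"] mS by simp
      then show ?case using Suc step[of j "n + k"] that by simp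
    qed simp
    \<comment> \<open>Position \<open>j\<close> is fixed from level \<open>Suc j\<close> on, since
      \<open>j < m (Suc j)\<close>.\<close>
    define y where "y j = f (Suc j) (u (Suc j)) j" for j
    have y: "y j = f n (u n) j" if "j < m n" for n j
    proof (cases "n \<le> Suc j")
      case True
      then show ?thesis using stable[OF that, of "Suc j - n"] by (simp add: y_def)
    next
      case False
      moreover have "j < m (Suc j)" using m[of "Suc j"] by simp
      ultimately show ?thesis using stable[of j "Suc j" "n - Suc j"] by (simp add: y_def)
    qed
    have "y \<in> Y"
    proof (rule finitely_closedD[OF closed])
      fix n
      have "\<forall>i<n. f n (u n) i = y i" using y[of _ n] m[of n] by simp
      then show "\<exists>y'\<in>Y. \<forall>i<n. y' i = y i" using fY[OF uL] Y'(1) by blast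
    qed
    moreover have "table_val (\<tau> n) (fst \<circ> y) = Some (c n)" for n
    proof -
      let ?k = "\<lambda>v. map (fst \<circ> f (Suc n) v) [0..<m (Suc n)]"
      have "map_of (map (\<lambda>v. (?k v, last v)) (l (Suc n))) (?k (u (Suc n))) = Some (last (u (Suc n)))"
      proof -
        have "map_of (map (\<lambda>v. (?k v, last v)) xs) (?k w) = Some (last w)"
          if "w \<in> set xs" "set xs \<subseteq> L (Suc n)" for w xs
          using that
        proof (induction xs)
          case (Cons v xs)
          show ?case
          proof (cases "v = w")
            case False
            then have "?k v \<noteq> ?k w" using Cons.prems inj[of "Suc n"] by (auto dest: inj_onD)
            then show ?thesis using Cons False by auto
          qed simp
        qed simp
        then show ?thesis using l uL by blast
      qed
      moreover have "map (fst \<circ> y) [0..<m (Suc n)] = ?k (u (Suc n))" using y[of _ "Suc n"] by simp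
      moreover have "last (u (Suc n)) = c n" by (simp add: u_def)
      ultimately show ?thesis by (simp only: table_val_def \<tau>_def fst_conv snd_conv)
    qed
    ultimately show ?thesis by blast
  qed
  then show ?thesis by blast
qed

section \<open>The first uncountable cardinal and coanalytic sets\<close>

abbreviation omega1 :: "nat set rel" where "omega1 \<equiv> cardSuc natLeq"

lemma omega1_Cinfinite: "Cinfinite omega1"
  by (rule Cinfinite_cardSuc) (rule natLeq_Cinfinite)

lemma card_of_Field_omega1: "|Field omega1| =o omega1"
  using omega1_Cinfinite card_of_Field_ordIso by blast

lemma omega1_wf: "wf (omega1 - Id)"
  using omega1_Cinfinite unfolding card_order_on_def well_order_on_def by blast

text \<open>By regularity, countably many closed initial segments, each smaller than
  \<open>omega1\<close>, do not exhaust it. Any element outside their union is a strict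
  bound.\<close>

lemma omega1_strict_bound:
  assumes "countable A" "A \<subseteq> Field omega1"
  shows "\<exists>w\<in>Field omega1. \<forall>a\<in>A. (a, w) \<in> omega1 - Id"
proof -
  have co: "Card_order omega1" using omega1_Cinfinite by blast
  have wo: "well_order_on (Field omega1) omega1" using co unfolding card_order_on_def by blast
  have "|A| <o omega1"
    using assms(1) cardSuc_greater[OF natLeq_Card_order] by (simp add: countable_card_le_natLeq ordLeq_ordLess_trans)
  moreover have "\<forall>a\<in>A. |insert a (underS omega1 a)| <o omega1"
  proof
    fix a assume "a \<in> A"
    then have "|underS omega1 a| <o omega1"
      using assms(2) card_of_underS[OF co] by blast
    moreover have "|{a}| <o omega1"
      by (intro Cfinite_ordLess_Cinfinite omega1_Cinfinite) (simp add: cfinite_def Field_card_of card_of_card_order_on)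
    ultimately have "|{a} \<union> underS omega1 a| <o omega1"
      using omega1_Cinfinite by (intro Un_Cinfinite_bound_strict)
    then show "|insert a (underS omega1 a)| <o omega1" by simp
  qed
  ultimately have "|\<Union>a\<in>A. insert a (underS omega1 a)| <o omega1"
    by (rule card_of_UNION_ordLess_infinite_Field_regularCard[OF regularCard_cardSuc[OF natLeq_Cinfinite] omega1_Cinfinite])
  then have "\<not> Field omega1 \<subseteq> (\<Union>a\<in>A. insert a (underS omega1 a))"
    using card_of_Field_omega1 card_of_mono1 by (meson not_ordLess_ordIso ordLeq_ordLess_trans)
  then obtain w where w: "w \<in> Field omega1" "\<And>a. a \<in> A \<Longrightarrow> w \<noteq> a \<and> w \<notin> underS omega1 a" by blast
  have "(a, w) \<in> omega1 - Id" if "a \<in> A" for a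
  proof -
    have "a \<noteq> w" "(w, a) \<notin> omega1" using w(2)[OF that] by (auto simp: underS_def)
    moreover have "total_on (Field omega1) omega1"
      using wo by (simp add: well_order_on_def linear_order_on_def)
    ultimately show ?thesis using that assms(2) w(1) by (auto simp: total_on_def)
  qed
  then show ?thesis using w(1) by blast
qed

text \<open>Shoenfield's tree: the complement of the projection of a closed set is the projection of the
  tree of attempts to build a rank function into the first uncountable cardinal.\<close>

lemma coprojection_perfect_table:
  fixes S :: "(nat \<Rightarrow> bool \<times> 'c::countable) set" and N :: "nat \<Rightarrow> nat set"
  assumes S: "finitely_closed S"
    and large: "\<not> |{\<alpha>. \<forall>y\<in>S. fst \<circ> y \<noteq> \<alpha>}| \<le>o omega1"
    and N: "\<And>n. finite (N n)"
  shows "\<exists>\<tau>. \<forall>c. (\<forall>n. c n \<in> N n) \<longrightarrow>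
    (\<exists>\<alpha>. (\<forall>y\<in>S. fst \<circ> y \<noteq> \<alpha>) \<and> (\<forall>n. table_val (\<tau> n) \<alpha> = Some (c n)))"
proof -
  \<comment> \<open>The tree of attempts to find a second coordinate over \<alpha>. It has no
    infinite branch exactly when \<alpha> is outside the projection of \<open>S\<close>, and this is
    what a rank function certifies.\<close>
  define T where "T \<alpha> = {l :: 'c list. \<exists>y\<in>S. \<forall>i<length l. y i = (\<alpha> i, l ! i)}" for \<alpha>
  define rank where "rank \<alpha> \<rho> \<longleftrightarrow> (\<forall>l. \<rho> l \<in> Field omega1) \<and>
      (\<forall>l k. l @ [k] \<in> T \<alpha> \<longrightarrow> (\<rho> (l @ [k]), \<rho> l) \<in> omega1 - Id)" for \<alpha> and \<rho> :: "'c list \<Rightarrow> nat set"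
  \<comment> \<open>An element of \<open>Y\<close> carries \<alpha> in its first coordinates and a
    rank function in its second ones, the rank of \<open>l\<close> standing at index
    \<open>to_nat l\<close>.\<close>
  define Y where "Y = {y. rank (fst \<circ> y) (\<lambda>l. snd (y (to_nat l))) \<and> (\<forall>n. snd (y n) \<in> Field omega1)}"
  have rank_iff: "(\<exists>\<rho>. rank \<alpha> \<rho>) \<longleftrightarrow> (\<forall>y\<in>S. fst \<circ> y \<noteq> \<alpha>)" for \<alpha>
  proof
    assume "\<exists>\<rho>. rank \<alpha> \<rho>"
    then obtain \<rho> where \<rho>: "rank \<alpha> \<rho>" ..
    show "\<forall>y\<in>S. fst \<circ> y \<noteq> \<alpha>"
    proof (intro ballI notI)
      fix y assume y: "y \<in> S" "fst \<circ> y = \<alpha>"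
      define u where "u n = map (snd \<circ> y) [0..<n]" for n
      have "u n \<in> T \<alpha>" for n
        unfolding T_def mem_Collect_eq using y by (intro bexI[of _ y]) (auto simp: u_def)
      moreover have "u (Suc n) = u n @ [snd (y n)]" for n by (simp add: u_def)
      ultimately have "(\<rho> (u (Suc n)), \<rho> (u n)) \<in> omega1 - Id" for n
        using \<rho> unfolding rank_def by metis
      then show False using omega1_wf wf_no_infinite_down_chainE[of _ "\<lambda>n. \<rho> (u n)"] by blast
    qed
  next
    assume \<alpha>: "\<forall>y\<in>S. fst \<circ> y \<noteq> \<alpha>"
    define R where "R = {(l @ [k], l) | l k. l @ [k] \<in> T \<alpha>}"
    have "wf R"
      unfolding wf_iff_no_infinite_down_chain
    proof
      assume "\<exists>f. \<forall>i. (f (Suc i), f i) \<in> R"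
      then obtain f where f: "\<And>i. (f (Suc i), f i) \<in> R" by blast
      have fk: "\<exists>k. f (Suc i) = f i @ [k] \<and> f (Suc i) \<in> T \<alpha>" for i
        using f[of i] unfolding R_def by auto
      then have fT: "f (Suc i) \<in> T \<alpha>" for i by blast
      from fk obtain k where k: "\<And>i. f (Suc i) = f i @ [k i]" by metis
      have len: "i \<le> length (f i)" for i by (induction i) (auto simp: k)
      have pre: "n < length (f (i + j)) \<and> f (i + j) ! n = f i ! n" if "n < length (f i)" for i j n
        using that by (induction j) (auto simp: k nth_append)
      define y where "y n = (\<alpha> n, f (Suc n) ! n)" for n
      have "y \<in> S"
      proof (rule finitely_closedD[OF S])
        fix n
        obtain y' where y': "y' \<in> S" "\<And>i. i < length (f (Suc n)) \<Longrightarrow> y' i = (\<alpha> i, f (Suc n) ! i)"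
          using fT[of n] unfolding T_def by blast
        have "y' i = y i" if "i < n" for i
        proof -
          have "f (Suc i + (n - i)) ! i = f (Suc i) ! i" using pre[of i "Suc i"] len[of "Suc i"] by simp
          moreover have "y' i = (\<alpha> i, f (Suc n) ! i)" using that len[of "Suc n"] by (intro y'(2)) simp
          ultimately show ?thesis using that by (simp add: y_def)
        qed
        then show "\<exists>y'\<in>S. \<forall>i<n. y' i = y i" using y'(1) by blast
      qed
      moreover have "fst \<circ> y = \<alpha>" by (auto simp: y_def)
      ultimately show False using \<alpha> by blast
    qed
    \<comment> \<open>Ranks are chosen by well-founded recursion: a node has only countably many
      children, so their ranks have a strict bound.\<close>
    have "\<exists>\<rho>. \<forall>l. \<rho> l \<in> Field omega1 \<and> (\<forall>k. l @ [k] \<in> T \<alpha> \<longrightarrow> (\<rho> (l @ [k]), \<rho> l) \<in> omega1 - Id)"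
    proof (rule dependent_wf_choice[OF \<open>wf R\<close>, where P = "\<lambda>\<rho> l w. w \<in> Field omega1 \<and> (\<forall>k. l @ [k] \<in> T \<alpha> \<longrightarrow> (\<rho> (l @ [k]), w) \<in> omega1 - Id)"])
      fix f g :: "'c list \<Rightarrow> nat set" and l w
      assume "\<And>z. (z, l) \<in> R \<Longrightarrow> f z = g z"
      then have "f (l @ [k]) = g (l @ [k])" if "l @ [k] \<in> T \<alpha>" for k using that unfolding R_def by blast
      then show "(w \<in> Field omega1 \<and> (\<forall>k. l @ [k] \<in> T \<alpha> \<longrightarrow> (f (l @ [k]), w) \<in> omega1 - Id)) =
          (w \<in> Field omega1 \<and> (\<forall>k. l @ [k] \<in> T \<alpha> \<longrightarrow> (g (l @ [k]), w) \<in> omega1 - Id))"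
        by (simp cong: conj_cong imp_cong)
    next
      fix l and f :: "'c list \<Rightarrow> nat set"
      assume f: "\<And>z. (z, l) \<in> R \<Longrightarrow> f z \<in> Field omega1 \<and> (\<forall>k. z @ [k] \<in> T \<alpha> \<longrightarrow> (f (z @ [k]), f z) \<in> omega1 - Id)"
      let ?A = "(\<lambda>k. f (l @ [k])) ` {k. l @ [k] \<in> T \<alpha>}"
      have cnt: "countable ?A" by simp
      have sub: "?A \<subseteq> Field omega1"
        using f unfolding R_def by blast
      obtain w where w: "w \<in> Field omega1" "\<forall>a\<in>?A. (a, w) \<in> omega1 - Id"
        by (rule bexE[OF omega1_strict_bound[OF cnt sub]])
      have "(f (l @ [k]), w) \<in> omega1 - Id" if "l @ [k] \<in> T \<alpha>" for k
        using that by (intro bspec[OF w(2)] imageI CollectI)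
      then show "\<exists>w. w \<in> Field omega1 \<and> (\<forall>k. l @ [k] \<in> T \<alpha> \<longrightarrow> (f (l @ [k]), w) \<in> omega1 - Id)"
        using w(1) by (intro exI[of _ w] conjI allI impI)
    qed
    then show "\<exists>\<rho>. rank \<alpha> \<rho>" unfolding rank_def by blast
  qed
  have fst_Y: "(\<lambda>y. fst \<circ> y) ` Y = {\<alpha>. \<forall>y\<in>S. fst \<circ> y \<noteq> \<alpha>}"
  proof (intro subset_antisym subsetI)
    fix \<alpha> assume "\<alpha> \<in> {\<alpha>. \<forall>y\<in>S. fst \<circ> y \<noteq> \<alpha>}"
    then obtain \<rho> where \<rho>: "rank \<alpha> \<rho>" using rank_iff by blast
    let ?y = "\<lambda>n. (\<alpha> n, \<rho> (from_nat n))"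
    have "fst \<circ> ?y = \<alpha>" by auto
    moreover from this have "?y \<in> Y" using \<rho> by (simp add: Y_def rank_def)
    ultimately show "\<alpha> \<in> (\<lambda>y. fst \<circ> y) ` Y" by (metis image_eqI)
  next
    fix \<alpha> assume "\<alpha> \<in> (\<lambda>y. fst \<circ> y) ` Y"
    then show "\<alpha> \<in> {\<alpha>. \<forall>y\<in>S. fst \<circ> y \<noteq> \<alpha>}" using rank_iff by (auto simp: Y_def)
  qed
  have closed: "finitely_closed Y"
    unfolding finitely_closed_def
  proof (intro allI impI)
    fix y :: "nat \<Rightarrow> bool \<times> nat set"
    assume y: "\<forall>n. \<exists>y'\<in>Y. \<forall>i<n. y' i = y i"
    have "snd (y n) \<in> Field omega1" for n
    proof -
      obtain y' where "y' \<in> Y" "y' n = y n"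
        using y by (metis lessI)
      then show ?thesis by (metis (mono_tags, lifting) Y_def mem_Collect_eq)
    qed
    moreover have "(snd (y (to_nat (l @ [k]))), snd (y (to_nat l))) \<in> omega1 - Id"
      if l: "l @ [k] \<in> T (fst \<circ> y)" for l k
    proof -
      \<comment> \<open>The rank condition for \<open>l\<close> and \<open>k\<close> involves two
        ranks and the first \<open>Suc (length l)\<close> bits; all of these lie below
        \<open>?n\<close>.\<close>
      let ?n = "Suc (to_nat l + to_nat (l @ [k]) + length l)"
      obtain y' where y': "y' \<in> Y" "\<And>i. i < ?n \<Longrightarrow> y' i = y i"
        using y by blast
      have "l @ [k] \<in> T (fst \<circ> y')"
      proof -
        obtain x where x: "x \<in> S" "\<And>i. i < length (l @ [k]) \<Longrightarrow> x i = ((fst \<circ> y) i, (l @ [k]) ! i)"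
          using l unfolding T_def by blast
        have "x i = ((fst \<circ> y') i, (l @ [k]) ! i)" if "i < length (l @ [k])" for i
          using x(2)[OF that] y'(2)[of i] that by simp
        then show ?thesis unfolding T_def using x(1) by blast
      qed
      then have "(snd (y' (to_nat (l @ [k]))), snd (y' (to_nat l))) \<in> omega1 - Id"
        using y'(1) by (simp add: Y_def rank_def)
      then show ?thesis using y'(2) by simp
    qed
    ultimately show "y \<in> Y" by (simp add: Y_def rank_def)
  qed
  have "\<exists>\<tau>. \<forall>c. (\<forall>n. c n \<in> N n) \<longrightarrow> (\<exists>y\<in>Y. \<forall>n. table_val (\<tau> n) (fst \<circ> y) = Some (c n))"
  proof (rule perfect_table[where r = omega1 and W = "Field omega1" and Y = Y and N = N])
    show "Cinfinite omega1" by (rule omega1_Cinfinite)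
    show "|Field omega1| \<le>o omega1" by (rule ordIso_imp_ordLeq[OF card_of_Field_omega1])
    show "finitely_closed Y" "\<And>n. finite (N n)" by fact+
    show "\<forall>y\<in>Y. \<forall>n. snd (y n) \<in> Field omega1" by (simp add: Y_def)
    show "\<not> |(\<lambda>y. fst \<circ> y) ` Y| \<le>o omega1" using large by (simp only: fst_Y not_False_eq_True)
  qed
  then obtain \<tau> where \<tau>: "\<And>c. (\<And>n. c n \<in> N n) \<Longrightarrow> \<exists>y\<in>Y. \<forall>n. table_val (\<tau> n) (fst \<circ> y) = Some (c n)"
    by blast
  have "\<exists>\<alpha>. (\<forall>y\<in>S. fst \<circ> y \<noteq> \<alpha>) \<and> (\<forall>n. table_val (\<tau> n) \<alpha> = Some (c n))" if "\<forall>n. c n \<in> N n" for c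
    using \<tau>[of c] that fst_Y by blast
  then show ?thesis by blast
qed

section \<open>Borel sets\<close>

lemma borel_eq_sigma_sets: "sets (borel :: 'a::topological_space measure) = sigma_sets UNIV {S. open S}"
  unfolding borel_def by simp

datatype borel_code = Base nat | Compl borel_code | Union "nat \<Rightarrow> borel_code"

primrec borel_decode :: "(nat \<Rightarrow> 'a set) \<Rightarrow> borel_code \<Rightarrow> 'a set" where
  "borel_decode U (Base n) = U n"
| "borel_decode U (Compl c) = - borel_decode U c"
| "borel_decode U (Union f) = (\<Union>n. borel_decode U (f n))"

text \<open>A code is a countably branching well-founded tree and is determined by the labels of its nodes.
  A path that is not in the tree gets an arbitrary label.\<close>

primrec borel_code_labels :: "borel_code \<Rightarrow> nat list \<Rightarrow> nat" where
  "borel_code_labels (Base n) = (\<lambda>l. n + 2)"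
| "borel_code_labels (Compl c) = case_list 0 (\<lambda>_ l. borel_code_labels c l)"
| "borel_code_labels (Union f) = case_list 1 (\<lambda>i l. borel_code_labels (f i) l)"

text \<open>The label of the empty path is 0, 1 or at least 2 and so reveals the constructor. The
  labels of the subcodes are found along the paths with a first step prepended.\<close>

lemma inj_borel_code_labels: "inj borel_code_labels"
proof (rule injI)
  fix c c' assume "borel_code_labels c = borel_code_labels c'"
  then show "c = c'"
  proof (induction c arbitrary: c')
    case (Base n)
    then show ?case by (cases c') (auto dest: fun_cong[of _ _ "[]"])
  next
    case (Compl c)
    show ?case
    proof (cases c')
      case (Compl d)
      have "borel_code_labels c l = borel_code_labels d l" for l
        using fun_cong[OF Compl.prems, of "0 # l"] Compl by simp
      then show ?thesis using Compl.IH[of d] Compl by blast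
    qed (use Compl.prems in \<open>auto dest: fun_cong[of _ _ "[]"]\<close>)
  next
    case (Union f)
    show ?case
    proof (cases c')
      case (Union g)
      have "borel_code_labels (f i) l = borel_code_labels (g i) l" for i l
        using fun_cong[OF Union.prems, of "i # l"] Union by simp
      then have "f i = g i" for i using Union.IH[of "f i" "g i"] by blast
      then show ?thesis using Union by blast
    qed (use Union.prems in \<open>auto dest: fun_cong[of _ _ "[]"]\<close>)
  qed
qed

text \<open>Every Borel set has a code over a countable basis, and the graph of its labelling is a
  subset of a countable set.\<close>

lemma card_of_borel_sets:
  "|sets (borel :: 'a::second_countable_topology measure)| \<le>o ( |UNIV :: (nat \<Rightarrow> bool) set| )"
proof -
  obtain \<B> :: "'a set set" where \<B>: "countable \<B>" "topological_basis \<B>"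
    using ex_countable_basis by blast
  \<comment> \<open>The empty set is added so that it has a code itself and can start the
    enumeration of a possibly empty subfamily of the basis.\<close>
  define U where "U = from_nat_into (insert {} \<B>)"
  have range: "range U = insert {} \<B>"
    unfolding U_def using \<B>(1) by (simp add: range_from_nat_into)
  have "\<exists>c. borel_decode U c = B" if "B \<in> sigma_sets UNIV {S :: 'a set. open S}" for B
    using that
  proof induction
    case (Basic S)
    then obtain \<B>' where \<B>': "\<B>' \<subseteq> \<B>" "\<Union>\<B>' = S"
      using \<B>(2) unfolding topological_basis_def by auto
    have "countable (insert {} \<B>')" using \<B>(1) \<B>'(1) countable_subset by blast
    then have V: "range (from_nat_into (insert {} \<B>')) = insert {} \<B>'" by (simp add: range_from_nat_into)
    have "\<exists>n. U n = from_nat_into (insert {} \<B>') k" for k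
    proof -
      have "from_nat_into (insert {} \<B>') k \<in> range U"
        unfolding range using V \<B>'(1) by blast
      then show ?thesis by (metis imageE)
    qed
    then obtain n where "\<And>k. U (n k) = from_nat_into (insert {} \<B>') k" by metis
    then have "borel_decode U (Union (\<lambda>k. Base (n k))) = \<Union> (range (from_nat_into (insert {} \<B>')))" by simp
    also have "\<dots> = S" unfolding V using \<B>'(2) by simp
    finally show ?case by blast
  next
    case Empty
    obtain n where "U n = {}" using range by (metis imageE insertI1)
    then have "borel_decode U (Base n) = {}" by simp
    then show ?case by blast
  next
    case (Compl A)
    then obtain c where "borel_decode U c = A" by blast
    then have "borel_decode U (borel_code.Compl c) = UNIV - A" by auto
    then show ?case by blast
  next
    case (Union A)
    then obtain f where "\<And>i. borel_decode U (f i) = A i" by metis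
    then have "borel_decode U (borel_code.Union f) = (\<Union>i. A i)" by simp
    then show ?case by blast
  qed
  then have "sets (borel :: 'a measure) \<subseteq> borel_decode U ` UNIV"
    unfolding borel_eq_sigma_sets by blast
  then have "|sets (borel :: 'a measure)| \<le>o |UNIV :: borel_code set|"
    using surj_imp_ordLeq by blast
  also have "|UNIV :: borel_code set| \<le>o |UNIV :: (nat \<times> nat \<Rightarrow> bool) set|"
  proof -
    define e where "e c = (\<lambda>(i, j). borel_code_labels c (from_nat i) = j)" for c
    have "inj e"
    proof (rule injI)
      fix c c' assume ee: "e c = e c'"
      have "borel_code_labels c l = borel_code_labels c' l" for l
        using fun_cong[OF ee, of "(to_nat l, borel_code_labels c l)"] by (simp add: e_def)
      then show "c = c'" using inj_borel_code_labels by (metis injD ext)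
    qed
    then show ?thesis by (intro card_of_ordLeqI[of e]) auto
  qed
  also have "|UNIV :: (nat \<times> nat \<Rightarrow> bool) set| \<le>o |UNIV :: (nat \<Rightarrow> bool) set|"
  proof -
    have "inj (\<lambda>f :: nat \<times> nat \<Rightarrow> bool. f \<circ> prod_decode)"
      using surj_prod_decode by (intro injI) (metis (no_types, lifting) comp_assoc surj_iff comp_id)
    then show ?thesis by (intro card_of_ordLeqI) auto
  qed
  finally show ?thesis .
qed

text \<open>Membership in \<open>B\<close> is witnessed by a branch \<open>w\<close>, through a relation that is sequentially
  closed for the product of the topology of the space and the topology of pointwise convergence
  in the discrete space of naturals.\<close>

definition seq_closed :: "('a::topological_space \<Rightarrow> (nat \<Rightarrow> nat) \<Rightarrow> bool) \<Rightarrow> bool" where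
  "seq_closed R \<longleftrightarrow> (\<forall>Y W y w. (\<forall>n. R (Y n) (W n)) \<longrightarrow> Y \<longlonglongrightarrow> y \<longrightarrow>
     (\<forall>k. \<forall>\<^sub>F n in sequentially. W n k = w k) \<longrightarrow> R y w)"

definition suslin :: "'a::topological_space set \<Rightarrow> bool" where
  "suslin B \<longleftrightarrow> (\<exists>R. seq_closed R \<and> (\<forall>y. y \<in> B \<longleftrightarrow> (\<exists>w. R y w)))"

lemma seq_closedD:
  "seq_closed R \<Longrightarrow> (\<And>n. R (Y n) (W n)) \<Longrightarrow> Y \<longlonglongrightarrow> y \<Longrightarrow>
    (\<And>k. \<forall>\<^sub>F n in sequentially. W n k = w k) \<Longrightarrow> R y w"
  unfolding seq_closed_def by blast

lemma suslin_closed: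
  assumes "closed B" shows "suslin B"
proof -
  have "seq_closed (\<lambda>y w. y \<in> B)"
    unfolding seq_closed_def using assms closed_sequentially by blast
  then show ?thesis unfolding suslin_def by (intro exI[of _ "\<lambda>y w. y \<in> B"]) simp
qed

text \<open>The first entry of the branch names a member of the union; the remaining entries witness
  membership in it.\<close>

lemma suslin_Union:
  fixes A :: "nat \<Rightarrow> 'a::topological_space set"
  assumes "\<And>i. suslin (A i)"
  shows "suslin (\<Union>i. A i)"
proof -
  have "\<forall>i. \<exists>R. seq_closed R \<and> (\<forall>y. y \<in> A i \<longleftrightarrow> (\<exists>w. R y w))"
    using assms unfolding suslin_def by blast
  then obtain R where R: "\<And>i. seq_closed (R i)" "\<And>i y. y \<in> A i \<longleftrightarrow> (\<exists>w. R i y w)"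
    by metis
  define Q where "Q y w = R (w 0) y (\<lambda>n. w (Suc n))" for y and w :: "nat \<Rightarrow> nat"
  have "seq_closed Q"
    unfolding seq_closed_def
  proof (intro allI impI)
    fix Y W y w
    assume Q: "\<forall>n. Q (Y n) (W n)" and Y: "Y \<longlonglongrightarrow> y" and W: "\<forall>k. \<forall>\<^sub>F n in sequentially. W n k = w k"
    \<comment> \<open>The named member is constant only from some index on, so an initial segment is
      dropped before its closed relation is applied.\<close>
    obtain n0 where n0: "\<And>n. n \<ge> n0 \<Longrightarrow> W n 0 = w 0"
      using W unfolding eventually_sequentially by blast
    show "Q y w"
      unfolding Q_def
    proof (rule seq_closedD[OF R(1)])
      show "R (w 0) (Y (n + n0)) (\<lambda>k. W (n + n0) (Suc k))" for n
        using Q n0[of "n + n0"] unfolding Q_def by (metis le_add2)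
      show "(\<lambda>n. Y (n + n0)) \<longlonglongrightarrow> y" using Y by (rule LIMSEQ_ignore_initial_segment)
      show "\<forall>\<^sub>F n in sequentially. W (n + n0) (Suc k) = w (Suc k)" for k
        using W sequentially_offset by blast
    qed
  qed
  moreover have "y \<in> (\<Union>i. A i) \<longleftrightarrow> (\<exists>w. Q y w)" for y
  proof
    assume "y \<in> (\<Union>i. A i)"
    then obtain i w where "R i y w" using R(2) by blast
    then have "Q y (case_nat i w)" by (simp add: Q_def)
    then show "\<exists>w. Q y w" by blast
  qed (use R(2) in \<open>auto simp: Q_def\<close>)
  ultimately show ?thesis unfolding suslin_def by blast
qed

text \<open>One branch interleaves witnesses for all \<open>i\<close>, the one for \<open>i\<close>
  at the positions \<open>prod_encode (i, n)\<close>.\<close>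

lemma suslin_Inter:
  fixes A :: "nat \<Rightarrow> 'a::topological_space set"
  assumes "\<And>i. suslin (A i)"
  shows "suslin (\<Inter>i. A i)"
proof -
  have "\<forall>i. \<exists>R. seq_closed R \<and> (\<forall>y. y \<in> A i \<longleftrightarrow> (\<exists>w. R y w))"
    using assms unfolding suslin_def by blast
  then obtain R where R: "\<And>i. seq_closed (R i)" "\<And>i y. y \<in> A i \<longleftrightarrow> (\<exists>w. R i y w)"
    by metis
  define Q where "Q y w \<longleftrightarrow> (\<forall>i. R i y (\<lambda>n. w (prod_encode (i, n))))" for y and w :: "nat \<Rightarrow> nat"
  have "seq_closed Q"
    unfolding seq_closed_def
  proof (intro allI impI)
    fix Y W y w
    assume Q: "\<forall>n. Q (Y n) (W n)" and Y: "Y \<longlonglongrightarrow> y" and W: "\<forall>k. \<forall>\<^sub>F n in sequentially. W n k = w k"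
    show "Q y w"
      unfolding Q_def
    proof (intro allI)
      fix i
      show "R i y (\<lambda>n. w (prod_encode (i, n)))"
        by (rule seq_closedD[OF R(1), of i Y "\<lambda>m n. W m (prod_encode (i, n))"]) (use Q Y W in \<open>auto simp: Q_def\<close>)
    qed
  qed
  moreover have "y \<in> (\<Inter>i. A i) \<longleftrightarrow> (\<exists>w. Q y w)" for y
  proof
    assume "y \<in> (\<Inter>i. A i)"
    then have "\<forall>i. \<exists>w. R i y w" using R(2) by blast
    then obtain w where "\<And>i. R i y (w i)" by metis
    then have "Q y (\<lambda>k. case prod_decode k of (i, n) \<Rightarrow> w i n)" by (simp add: Q_def)
    then show "\<exists>w. Q y w" by blast
  qed (use R(2) in \<open>auto simp: Q_def\<close>)
  ultimately show ?thesis unfolding suslin_def by blast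
qed

lemma suslin_open:
  fixes U :: "'a::metric_space set"
  assumes "open U" shows "suslin U"
proof -
  have "fsigma_in euclidean U"
    using assms by (intro open_imp_fsigma_in) (auto simp: metrizable_space_euclidean)
  then obtain F :: "nat \<Rightarrow> 'a set" where "\<And>n. closed (F n)" "\<Union> (range F) = U"
    unfolding fsigma_in_ascending by (auto simp: closed_closedin[symmetric])
  then show ?thesis using suslin_Union[of F] suslin_closed by auto
qed

lemma suslin_borel:
  fixes B :: "'a::metric_space set"
  assumes "B \<in> sets borel"
  shows "suslin B"
proof -
  \<comment> \<open>Carrying the complement along makes the complement step of the induction
    trivial.\<close>
  have "suslin B \<and> suslin (- B)"
    using assms unfolding borel_eq_sigma_sets
  proof induction
    case (Basic S)
    then show ?case by (auto intro: suslin_open suslin_closed)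
  next
    case Empty
    then show ?case by (auto intro: suslin_closed)
  next
    case (Compl A)
    then show ?case by (simp add: Compl_eq_Diff_UNIV[symmetric])
  next
    case (Union A)
    then show ?case using suslin_Union[of A] suslin_Inter[of "\<lambda>i. - A i"] by (simp add: Compl_UN)
  qed
  then show ?thesis ..
qed

section \<open>Groups with a two-sided invariant metric\<close>

locale tsi_metric = Metric_space UNIV d
  for d :: "'a::{polish_space,topological_group_add} \<Rightarrow> 'a \<Rightarrow> real" +
  assumes mtopology_eq: "mtopology = euclidean"
    and d_left [simp]: "d (z + x) (z + y) = d x y"
    and d_right [simp]: "d (x + z) (y + z) = d x y"
begin

lemma d_add: "d (x + y) (x' + y') \<le> d x x' + d y y'"
  using triangle[of "x + y" "x' + y" "x' + y'"] by simp

lemma d_triangle: "d x z \<le> d x y + d y z"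
  using triangle by simp

lemma d_add_right: "d (x + y) x = d y 0"
  using d_left[of x y 0] by (simp del: d_left)

lemma tendsto_iff_d: "(X \<longlongrightarrow> l) F \<longleftrightarrow> ((\<lambda>n. d (X n) l) \<longlongrightarrow> 0) F"
  using limitin_metric_dist_null[of X l F] unfolding mtopology_eq by simp

lemma tendsto_iff_d_less: "X \<longlonglongrightarrow> l \<longleftrightarrow> (\<forall>e>0. \<exists>N. \<forall>n\<ge>N. d (X n) l < e)"
  unfolding tendsto_iff_d lim_sequentially by (simp add: dist_real_def)

lemma dist_small:
  assumes "0 < e"
  shows "\<exists>s>0. \<forall>y. d x y < s \<longrightarrow> dist x y < e"
proof -
  have "openin mtopology (ball x e)" unfolding mtopology_eq by simp
  moreover have "x \<in> ball x e" using assms by simp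
  ultimately obtain s where "s > 0" "mball x s \<subseteq> ball x e"
    unfolding openin_mtopology by blast
  then show ?thesis by (intro exI[of _ s]) auto
qed

lemma open_contains_d_ball:
  assumes "open U" "x \<in> U"
  shows "\<exists>s>0. \<forall>y. d x y < s \<longrightarrow> y \<in> U"
proof -
  have "openin mtopology U" unfolding mtopology_eq using assms(1) by simp
  then obtain s where "s > 0" "mball x s \<subseteq> U"
    unfolding openin_mtopology using assms(2) by auto
  then show ?thesis by (intro exI[of _ s]) auto
qed

lemma open_d_ball: "open {y. d x y < s}"
proof -
  have "openin mtopology (mball x s)" by simp
  moreover have "mball x s = {y. d x y < s}" by auto
  ultimately show ?thesis unfolding mtopology_eq by simp
qed

text \<open>Let \<open>X\<close> be Cauchy for \<open>d\<close>. In the completion of the group for \<open>d\<close> the group is comeager, and so is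
  its translate by the limit of \<open>X\<close>; a point in both is the limit of a sequence \<open>g\<close> such that
  \<open>g k\<close> and \<open>X (n k) + g k\<close> converge in the group. The nested balls below build \<open>g\<close>.\<close>

lemma mcomplete: mcomplete
  unfolding mcomplete_def
proof (intro allI impI)
  fix X assume X: "MCauchy X"
  have tail: "\<exists>n>n0. \<forall>m\<ge>n. d (X m) (X n) < e" if e: "e > 0" for e n0
  proof -
    obtain N where N: "\<And>n n'. N \<le> n \<Longrightarrow> N \<le> n' \<Longrightarrow> d (X n) (X n') < e"
      using X e unfolding MCauchy_def by meson
    show ?thesis by (rule exI[of _ "max N (Suc n0)"]) (use N[of _ "max N (Suc n0)"] in auto)
  qed
  have ball: "\<exists>s>0. s \<le> e' \<and> (\<forall>y. d x y < s \<longrightarrow> dist x y < (1/2)^k)" if e': "e' > 0" for e' x and k :: nat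
  proof -
    obtain s where "s > 0" "\<forall>y. d x y < s \<longrightarrow> dist x y < (1/2)^k" using dist_small[of "(1/2)^k" x] by auto
    then show ?thesis using e' by (intro exI[of _ "min s e'"]) auto
  qed
  \<comment> \<open>The radii \<open>s\<close> and \<open>r\<close> belong to \<open>g\<close> and
    to \<open>X n + g\<close>. On these balls \<open>dist\<close> is controlled by a power of 1/2,
    which transfers convergence to the complete metric \<open>dist\<close>.\<close>
  define P where "P k S \<longleftrightarrow> (case S of (g, n, s, r) \<Rightarrow> 0 < s \<and> 0 < r \<and> r \<le> s / 2 \<and> k \<le> n \<and>
      (\<forall>m\<ge>n. d (X m) (X n) < s / 4) \<and>
      (\<forall>y. d g y < s \<longrightarrow> dist g y < (1/2)^k) \<and>
      (\<forall>y. d (X n + g) y < r \<longrightarrow> dist (X n + g) y < (1/2)^k))"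
    for k :: nat and S :: "'a \<times> nat \<times> real \<times> real"
  define Q where "Q S S' \<longleftrightarrow> (case S of (g, n, s, r) \<Rightarrow> case S' of (g', n', s', r') \<Rightarrow>
      n < n' \<and> d g g' \<le> s / 4 \<and> s' \<le> s / 4 \<and> d (X n + g) (X n' + g') \<le> r / 4 \<and> r' \<le> r / 4)"
    for S S' :: "'a \<times> nat \<times> real \<times> real"
  have "\<exists>S. \<forall>k. P k (S k) \<and> Q (S k) (S (Suc k))"
  proof (rule dependent_nat_choice)
    obtain s where s: "s > 0" "\<forall>y. d 0 y < s \<longrightarrow> dist 0 y < (1/2)^(0::nat)" using ball[of 1 0 0] by auto
    obtain n where n: "\<forall>m\<ge>n. d (X m) (X n) < s / 4" using tail[of "s/4" 0] s by auto
    obtain r where "r > 0" "r \<le> s / 2" "\<forall>y. d (X n + 0) y < r \<longrightarrow> dist (X n + 0) y < (1/2)^(0::nat)"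
      using ball[of "s / 2" "X n + 0" 0] s by auto
    then have "P 0 (0, n, s, r)" unfolding P_def using s n by simp
    then show "\<exists>S. P 0 S" ..
  next
    fix S k assume "P k S"
    moreover obtain g n s r where S: "S = (g, n, s, r)" by (cases S)
    ultimately have *: "0 < s" "0 < r" "r \<le> s / 2" "k \<le> n" "\<And>m. m \<ge> n \<Longrightarrow> d (X m) (X n) < s / 4"
      unfolding P_def by auto
    obtain n1 where n1: "n1 > n" "\<And>m. m\<ge>n1 \<Longrightarrow> d (X m) (X n1) < r / 4"
      using tail[of "r / 4" n] * by auto
    \<comment> \<open>This choice keeps \<open>X n1 + g1 = X n + g\<close> and moves
      \<open>g\<close> only by the distance of \<open>X n1\<close> and \<open>X n\<close>. The later
      passage to \<open>n2\<close> moves the sum by at most \<open>r / 4\<close>.\<close>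
    define g1 where "g1 = - X n1 + (X n + g)"
    obtain s1 where s1: "s1 > 0" "s1 \<le> r / 2" "\<forall>y. d g1 y < s1 \<longrightarrow> dist g1 y < (1/2)^(Suc k)"
      using ball[of "r / 2" g1 "Suc k"] * by auto
    obtain n2 where n2: "n2 > n1" "\<forall>m\<ge>n2. d (X m) (X n2) < s1 / 4"
      using tail[of "s1 / 4" n1] s1 by auto
    obtain r1 where r1: "r1 > 0" "r1 \<le> s1 / 2" "\<forall>y. d (X n2 + g1) y < r1 \<longrightarrow> dist (X n2 + g1) y < (1/2)^(Suc k)"
      using ball[of "s1 / 2" "X n2 + g1" "Suc k"] s1 by auto
    have "P (Suc k) (g1, n2, s1, r1)"
      unfolding P_def using s1 r1 n1(1) n2 *(4) by auto
    moreover have "Q S (g1, n2, s1, r1)"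
    proof -
      have eq: "X n1 + g1 = X n + g" by (simp add: g1_def)
      have "d g g1 = d (X n1 + g) (X n1 + g1)" by simp
      also have "\<dots> = d (X n1) (X n)" unfolding eq by simp
      finally have "d g g1 \<le> s / 4" using *(5)[of n1] n1(1) by simp
      moreover have "d (X n + g) (X n2 + g1) = d (X n2) (X n1)"
        unfolding eq[symmetric] by (simp add: commute)
      then have "d (X n + g) (X n2 + g1) \<le> r / 4" using n1(2)[of n2] n2(1) by simp
      ultimately show ?thesis unfolding Q_def S using n1(1) n2(1) s1 r1 * by auto
    qed
    ultimately show "\<exists>S'. P (Suc k) S' \<and> Q S S'" by blast
  qed
  then obtain S where S: "\<And>k. P k (S k)" "\<And>k. Q (S k) (S (Suc k))" by blast
  define g n s r where "g = fst \<circ> S" and "n = fst \<circ> snd \<circ> S" and "s = fst \<circ> snd \<circ> snd \<circ> S" and "r = snd \<circ> snd \<circ> snd \<circ> S"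
  have S_eq: "S k = (g k, n k, s k, r k)" for k by (simp add: g_def n_def s_def r_def)
  define b where "b k = X (n k) + g k" for k
  have pos: "0 < s k" "0 < r k" and small: "\<And>y. d (g k) y < s k \<Longrightarrow> dist (g k) y < (1/2)^k"
    "\<And>y. d (b k) y < r k \<Longrightarrow> dist (b k) y < (1/2)^k" for k
    using S(1)[of k] unfolding P_def S_eq b_def by auto
  have step: "n k < n (Suc k)" "d (g k) (g (Suc k)) \<le> s k / 4" "s (Suc k) \<le> s k / 4"
    "d (b k) (b (Suc k)) \<le> r k / 4" "r (Suc k) \<le> r k / 4" for k
    using S(2)[of k] unfolding Q_def S_eq b_def by auto
  \<comment> \<open>Geometrically shrinking steps stay inside the ball of radius \<open>e k\<close>
    about \<open>x k\<close>, so the sequence is Cauchy for \<open>dist\<close>.\<close>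
  have conv: "convergent x"
    if xp: "\<And>k. 0 < (e k :: real)" and xs: "\<And>k y. d (x k) y < e k \<Longrightarrow> dist (x k) y < (1/2)^k"
      and xd: "\<And>k. d (x k) (x (Suc k)) \<le> e k / 4" and xe: "\<And>k. e (Suc k) \<le> e k / 4" for x :: "nat \<Rightarrow> 'a" and e
  proof -
    have "d (x k) (x (k + j)) \<le> e k / 2 - e (k + j) / 2" for k j
    proof (induction j)
      case (Suc j)
      have "d (x k) (x (k + Suc j)) \<le> d (x k) (x (k + j)) + d (x (k + j)) (x (Suc (k + j)))"
        using d_triangle by simp
      then show ?case using Suc xd[of "k+j"] xe[of "k+j"] xp[of "k+j"] by simp
    qed simp
    then have "d (x k) (x (k + j)) < e k" for k j
      using xp[of k] xp[of "k + j"] by (smt (verit, best) field_sum_of_halves)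
    then have near: "dist (x k) (x j) < (1/2)^k" if "j \<ge> k" for k j
      using xs that by (metis le_add_diff_inverse)
    have "Cauchy x"
    proof (rule metric_CauchyI)
      fix \<eta> :: real assume "\<eta> > 0"
      then obtain k where k: "(1/2)^k < \<eta> / 2" using real_arch_pow_inv[of "\<eta>/2" "1/2"] by auto
      have "dist (x i) (x j) < \<eta>" if "i \<ge> k" "j \<ge> k" for i j
        using near[OF that(1)] near[OF that(2)] k dist_triangle3[of "x i" "x j" "x k"] by linarith
      then show "\<exists>M. \<forall>m\<ge>M. \<forall>n\<ge>M. dist (x m) (x n) < \<eta>" by blast
    qed
    then show ?thesis by (simp add: Cauchy_convergent_iff)
  qed
  obtain g' where g': "g \<longlonglongrightarrow> g'"
    using conv[of s g] pos small step unfolding convergent_def by blast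
  obtain b' where b': "b \<longlonglongrightarrow> b'"
    using conv[of r b] pos small step unfolding convergent_def by blast
  \<comment> \<open>These differences are the terms \<open>X (n k)\<close>, so a subsequence of the
    Cauchy sequence converges.\<close>
  have "(\<lambda>k. b k - g k) \<longlonglongrightarrow> b' - g'" using b' g' by (rule tendsto_diff)
  then have "limitin mtopology (X \<circ> n) (b' - g') sequentially"
    unfolding mtopology_eq by (simp add: b_def comp_def)
  moreover have "strict_mono n" using step(1) by (rule strict_mono_Suc_iff[THEN iffD2, rule_format])
  ultimately show "\<exists>x. limitin mtopology X x sequentially"
    using MCauchy_convergent_subsequence X by blast
qed

lemma d_Cauchy_convergent:
  assumes "\<And>e. e > 0 \<Longrightarrow> \<exists>N. \<forall>m\<ge>N. \<forall>n\<ge>N. d (X m) (X n) < e"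
  shows "\<exists>x. X \<longlonglongrightarrow> x"
proof -
  have "MCauchy X" unfolding MCauchy_def using assms by auto
  then have "\<exists>x. limitin mtopology X x sequentially" using mcomplete unfolding mcomplete_def by blast
  then show ?thesis unfolding mtopology_eq by simp
qed

text \<open>Otherwise the ball has finite nets of every mesh. By completeness its closure is then
  compact, and translates of it are compact neighbourhoods of all points.\<close>

lemma separated_in_ball:
  assumes nlc: "\<not> locally_compact_space (euclidean :: 'a topology)" and "\<delta> > 0"
  shows "\<exists>\<epsilon>>0. \<forall>F. finite F \<longrightarrow> (\<exists>g. d g 0 < \<delta> \<and> (\<forall>f\<in>F. \<epsilon> \<le> d g f))"
proof (rule ccontr)
  assume contr: "\<not> ?thesis"
  have cover: "\<exists>F. finite F \<and> (\<forall>g. d g 0 < \<delta> \<longrightarrow> (\<exists>f\<in>F. d g f < \<epsilon>))" if "\<epsilon> > 0" for \<epsilon>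
    using contr that by (meson not_le)
  have "\<exists>K. finite K \<and> K \<subseteq> mball 0 \<delta> \<and> mball 0 \<delta> \<subseteq> (\<Union>x\<in>K. mball x \<epsilon>)" if eps: "\<epsilon> > 0" for \<epsilon>
  proof -
    obtain F where F: "finite F" "\<And>g. d g 0 < \<delta> \<Longrightarrow> \<exists>f\<in>F. d g f < \<epsilon> / 2"
      using cover[of "\<epsilon> / 2"] eps by auto
    \<comment> \<open>Centres of a net may lie outside the ball. Each useful one is replaced by a
      nearby point of the ball, at the price of doubling the mesh.\<close>
    define c where "c f = (SOME g. d g 0 < \<delta> \<and> d g f < \<epsilon> / 2)" for f
    have c: "d (c f) 0 < \<delta> \<and> d (c f) f < \<epsilon> / 2" if "d g 0 < \<delta>" "d g f < \<epsilon> / 2" for f g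
      unfolding c_def by (rule someI[of _ g]) (use that in simp)
    let ?K = "{x \<in> c ` F. d x 0 < \<delta>}"
    have "\<exists>x\<in>?K. d x g < \<epsilon>" if g: "d g 0 < \<delta>" for g
    proof -
      obtain f where f: "f \<in> F" "d g f < \<epsilon> / 2" using F(2)[OF g] by blast
      then have "d (c f) g < \<epsilon>"
        using c[OF g f(2)] d_triangle[of "c f" g f] commute[of f g] by linarith
      then show ?thesis using f(1) c[OF g f(2)] by blast
    qed
    then show ?thesis by (intro exI[of _ ?K]) (use F(1) in \<open>auto simp: commute\<close>)
  qed
  then have "mtotally_bounded (mball 0 \<delta>)"
    unfolding mtotally_bounded_def by simp
  then have K: "compact (closure (mball 0 \<delta>))"
    using mtotally_bounded_eq_compact_closure_of[OF mcomplete] unfolding mtopology_eq by simp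
  have "locally_compact_space (euclidean :: 'a topology)"
    unfolding locally_compact_space_def
  proof (intro ballI)
    fix x :: 'a
    let ?U = "{y. d x y < \<delta>}" and ?K = "(+) x ` closure (mball 0 \<delta>)"
    have "?U \<subseteq> ?K"
    proof
      fix y assume "y \<in> ?U"
      then have "d (x + 0) (x + (- x + y)) < \<delta>" by (simp only: mem_Collect_eq add_0_right add_minus_cancel)
      then have "- x + y \<in> closure (mball 0 \<delta>)"
        unfolding d_left by (intro closure_subset[THEN subsetD]) (simp only: in_mball UNIV_I simp_thms)
      then have "x + (- x + y) \<in> ?K" by (rule imageI)
      then show "y \<in> ?K" by (simp only: add_minus_cancel)
    qed
    moreover have "compact ?K"
      using K by (rule compact_continuous_image[rotated]) (intro continuous_intros)
    moreover have "x \<in> ?U" using assms(2) by simp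
    moreover have "open ?U" by (rule open_d_ball)
    ultimately show "\<exists>U K. openin euclidean U \<and> compactin euclidean K \<and> x \<in> U \<and> U \<subseteq> K"
      by (intro exI[of _ ?U] exI[of _ ?K]) simp
  qed
  then show False using nlc by simp
qed

section \<open>Infinite sums in a possibly non-abelian group\<close>

primrec psum :: "(nat \<Rightarrow> 'a) \<Rightarrow> nat \<Rightarrow> 'a" where
  "psum f 0 = 0"
| "psum f (Suc n) = psum f n + f n"

definition tsum :: "(nat \<Rightarrow> 'a) \<Rightarrow> 'a" where
  "tsum f = lim (psum f)"

lemma psum_cong: "(\<And>i. i < n \<Longrightarrow> f i = f' i) \<Longrightarrow> psum f n = psum f' n"
  by (induction n) auto

definition halving :: "(nat \<Rightarrow> real) \<Rightarrow> bool" where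
  "halving b \<longleftrightarrow> (\<forall>n. 0 \<le> b n \<and> b (Suc n) \<le> b n / 2)"

lemma halving_small:
  assumes "halving b" "e > 0"
  shows "\<exists>n. b n < e"
proof -
  have "b n \<le> b 0 * (1/2)^n" for n
    by (induction n) (use assms(1) in \<open>auto simp: halving_def intro: order_trans\<close>)
  moreover have "(\<lambda>n. b 0 * (1/2)^n) \<longlonglongrightarrow> b 0 * 0"
    by (intro tendsto_mult tendsto_const LIMSEQ_power_zero) simp
  then have "\<forall>\<^sub>F n in sequentially. b 0 * (1/2)^n < e"
    using assms(2) by (auto dest: order_tendstoD)
  ultimately show ?thesis
    by (metis (no_types, lifting) eventually_sequentially le_refl order_le_less_trans)
qed

lemma halving_mono: "halving b \<Longrightarrow> n \<le> m \<Longrightarrow> b m \<le> b n"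
proof (rule lift_Suc_antimono_le[of b])
  fix n assume "halving b"
  then have "0 \<le> b n" "b (Suc n) \<le> b n / 2" by (simp_all add: halving_def)
  then show "b (Suc n) \<le> b n" by linarith
qed

text \<open>Telescoping, since \<open>b i \<le> 2 * b i - 2 * b (Suc i)\<close> for a halving
  sequence.\<close>

lemma psum_Cauchy:
  assumes b: "halving b" and f: "\<And>i. d (f i) 0 \<le> b i"
  shows "d (psum f n) (psum f (n + k)) \<le> 2 * b n - 2 * b (n + k)"
proof (induction k)
  case (Suc k)
  have "d (psum f n) (psum f (n + Suc k)) \<le> d (psum f n) (psum f (n + k)) + d (psum f (n + k)) (psum f (n + k) + f (n + k))"
    using d_triangle by simp
  also have "d (psum f (n + k)) (psum f (n + k) + f (n + k)) = d (f (n + k)) 0"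
    by (subst commute) (rule d_add_right)
  finally show ?case using Suc f[of "n+k"] b by (auto simp: halving_def dest!: spec[of _ "n+k"])
qed simp

lemma psum_tendsto:
  assumes b: "halving b" and f: "\<And>i. d (f i) 0 \<le> b i"
  shows "psum f \<longlonglongrightarrow> tsum f"
proof -
  have bnn: "0 \<le> b n" for n using b by (simp add: halving_def)
  have near: "d (psum f n) (psum f m) \<le> 2 * b n" if "n \<le> m" for n m
    using psum_Cauchy[where f = f and b = b and n = n and k = "m - n", OF b f] that bnn[of m] by simp
  have "\<exists>x. psum f \<longlonglongrightarrow> x"
  proof (rule d_Cauchy_convergent)
    fix e :: real assume "e > 0"
    then obtain N where N: "b N < e / 4" using halving_small[OF b, of "e/4"] by auto
    have "d (psum f m) (psum f n) < e" if "m \<ge> N" "n \<ge> N" for m n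
      using near[OF that(1)] near[OF that(2)] N d_triangle[of "psum f m" "psum f n" "psum f N"]
        commute[of "psum f m" "psum f N"] by linarith
    then show "\<exists>N. \<forall>m\<ge>N. \<forall>n\<ge>N. d (psum f m) (psum f n) < e" by blast
  qed
  then show ?thesis unfolding tsum_def by (metis limI)
qed

lemma psum_near_tsum:
  assumes b: "halving b" and f: "\<And>i. d (f i) 0 \<le> b i"
  shows "d (psum f n) (tsum f) \<le> 2 * b n"
proof (rule field_le_epsilon)
  fix e :: real assume "e > 0"
  then obtain N where N: "\<forall>m\<ge>N. d (psum f m) (tsum f) < e"
    using psum_tendsto[OF b f] unfolding tendsto_iff_d_less by blast
  have "0 \<le> b (n + N)" using b by (simp add: halving_def)
  then have "d (psum f n) (psum f (n + N)) \<le> 2 * b n"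
    using psum_Cauchy[where f = f and b = b and n = n and k = N, OF b f] by simp
  then show "d (psum f n) (tsum f) \<le> 2 * b n + e"
    using N[rule_format, of "n + N"] d_triangle[of "psum f n" "tsum f" "psum f (n + N)"] by simp
qed

lemma tsum_near:
  assumes b: "halving b" and f: "\<And>i. d (f i) 0 \<le> b i" and f': "\<And>i. d (f' i) 0 \<le> b i"
    and eq: "\<And>i. i < n \<Longrightarrow> f i = f' i"
  shows "d (tsum f) (tsum f') \<le> 4 * b n"
proof -
  have "psum f n = psum f' n" using eq by (rule psum_cong)
  then show ?thesis
    using psum_near_tsum[where f = f and n = n, OF b f] psum_near_tsum[where f = f' and n = n, OF b f']
      d_triangle[of "tsum f" "tsum f'" "psum f n"] commute[of "tsum f" "psum f n"] by simp
qed

lemma tsum_tendsto: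
  assumes b: "halving b" and F: "\<And>k i. d (F k i) 0 \<le> b i" and f: "\<And>i. d (f i) 0 \<le> b i"
    and ev: "\<And>i. \<forall>\<^sub>F k in sequentially. F k i = f i"
  shows "(\<lambda>k. tsum (F k)) \<longlonglongrightarrow> tsum f"
  unfolding tendsto_iff_d_less
proof (intro allI impI)
  fix e :: real assume "e > 0"
  then obtain n where n: "b n < e / 4" using halving_small[OF b, of "e/4"] by auto
  have "\<forall>\<^sub>F k in sequentially. \<forall>i\<in>{..<n}. F k i = f i"
    using ev by (intro eventually_ball_finite) auto
  then obtain N where N: "\<And>k. k \<ge> N \<Longrightarrow> \<forall>i\<in>{..<n}. F k i = f i"
    unfolding eventually_sequentially by blast
  have "d (tsum (F k)) (tsum f) < e" if "k \<ge> N" for k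
    using tsum_near[where f = "F k" and f' = f and n = n, OF b F f] N[OF that] n by force
  then show "\<exists>N. \<forall>k\<ge>N. d (tsum (F k)) (tsum f) < e" by blast
qed

end

lemma exists_first_difference:
  assumes "z \<noteq> (z' :: nat \<Rightarrow> 'b)"
  obtains n where "z n \<noteq> z' n" "\<And>i. i < n \<Longrightarrow> z i = z' i"
proof -
  have "\<exists>n. z n \<noteq> z' n" using assms by blast
  then show thesis using that[of "LEAST n. z n \<noteq> z' n"] not_less_Least LeastI_ex by (metis (mono_tags, lifting))
qed

section \<open>Sets with lacunary distances\<close>

text \<open>
  The constants are chosen in the order \<open>\<delta> 0\<close>, \<open>\<epsilon> 0\<close>, \<open>a 0\<close>, \<open>\<delta> 1\<close>, \<open>\<epsilon> 1\<close>, \<dots>. The Cantor set consists of the sums of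
  subsequences of \<open>a\<close>, and its positive distances lie in the intervals between \<open>6 * \<delta> (Suc n)\<close> and
  \<open>\<epsilon> n / 2\<close>. The shift of a sequence \<open>z\<close> of tables is the infinite sum of the elements \<open>\<gamma> n (z n)\<close>. If
  \<open>z\<close> and \<open>z'\<close> differ first at \<open>n\<close>, then \<open>gamma_separated\<close> keeps the points that they contribute to
  \<open>piece \<alpha>\<close> more than \<open>\<epsilon> n / 2\<close> apart; and for \<open>n > 0\<close> they are at most \<open>6 * \<delta> n\<close> apart, since they use the
  same approximation at \<open>n - 1\<close>.
\<close>

locale tsi_scheme = tsi_metric d
  for d :: "'a::{polish_space,topological_group_add} \<Rightarrow> 'a \<Rightarrow> real" +
  fixes \<delta> \<epsilon> :: "nat \<Rightarrow> real" and a q :: "nat \<Rightarrow> 'a" and \<gamma> :: "nat \<Rightarrow> table \<Rightarrow> 'a"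
  assumes eps_pos: "0 < \<epsilon> n" and eps_le: "\<epsilon> n \<le> \<delta> n"
    and a_pos: "0 < d (a n) 0" and a_less: "d (a n) 0 < \<epsilon> n / 4"
    and delta_Suc: "\<delta> (Suc n) = d (a n) 0 / 24"
    and gamma_small: "d (\<gamma> n \<tau>) 0 \<le> \<delta> n"
    and gamma_separated: "\<tau> \<noteq> \<tau>' \<Longrightarrow> table_val \<tau> \<alpha> = Some i \<Longrightarrow> table_val \<tau>' \<alpha> = Some j \<Longrightarrow>
      \<epsilon> n \<le> d (\<gamma> n \<tau> + q i) (\<gamma> n \<tau>' + q j)"
    and q_dense: "0 < e \<Longrightarrow> \<exists>i. d (q i) x < e"
begin

lemma delta_Suc_less: "\<delta> (Suc n) < \<epsilon> n / 96"
  using a_less[of n] delta_Suc[of n] by simp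

lemma delta_pos: "0 < \<delta> n"
  using eps_pos[of n] eps_le[of n] by simp

lemma halving_delta: "halving \<delta>"
  unfolding halving_def
proof
  fix n
  show "0 \<le> \<delta> n \<and> \<delta> (Suc n) \<le> \<delta> n / 2"
    using delta_pos[of n] delta_Suc_less[of n] eps_le[of n] eps_pos[of n] by simp
qed

lemma halving_a: "halving (\<lambda>n. d (a n) 0)"
  unfolding halving_def
proof
  fix n
  show "0 \<le> d (a n) 0 \<and> d (a (Suc n)) 0 \<le> d (a n) 0 / 2"
    using a_pos[of n] a_less[of "Suc n"] eps_le[of "Suc n"] delta_Suc[of n] by (intro conjI nonneg) linarith
qed

lemma eps_antimono: "n \<le> m \<Longrightarrow> \<epsilon> m \<le> \<epsilon> n"
proof (rule lift_Suc_antimono_le[of \<epsilon>])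
  fix n
  show "\<epsilon> (Suc n) \<le> \<epsilon> n"
    using eps_le[of "Suc n"] delta_Suc_less[of n] eps_pos[of n] by linarith
qed

lemma delta_antimono: "n \<le> m \<Longrightarrow> \<delta> m \<le> \<delta> n"
  by (rule halving_mono[OF halving_delta])

lemma delta_small: "0 < e \<Longrightarrow> \<exists>n. \<delta> n < e"
  by (rule halving_small[OF halving_delta])

section \<open>The Cantor set and its distances\<close>

definition cantor :: "(nat \<Rightarrow> bool) \<Rightarrow> 'a" where
  "cantor w = tsum (\<lambda>i. if w i then a i else 0)"

definition cantor_gap :: "real \<Rightarrow> bool" where
  "cantor_gap x \<longleftrightarrow> (\<exists>n. 6 * \<delta> (Suc n) < x \<and> x < \<epsilon> n / 2)"

lemma digit_small: "d (if b then a i else 0) 0 \<le> d (a i) 0"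
  by simp

lemma cantor_near:
  assumes "\<And>i. i < n \<Longrightarrow> w i = w' i"
  shows "d (cantor w) (cantor w') \<le> 4 * d (a n) 0"
  unfolding cantor_def
  using tsum_near[OF halving_a, of "\<lambda>i. if w i then a i else 0" "\<lambda>i. if w' i then a i else 0" n]
    assms digit_small by simp

text \<open>The common initial sums cancel by invariance and leave exactly \<open>a n\<close>; each
  of the two tails contributes at most \<open>2 * d (a (Suc n)) 0\<close>.\<close>

lemma cantor_first_difference:
  assumes "w n \<noteq> w' n" "\<And>i. i < n \<Longrightarrow> w i = w' i"
  shows "\<bar>d (cantor w) (cantor w') - d (a n) 0\<bar> \<le> 4 * d (a (Suc n)) 0"
proof -
  let ?f = "\<lambda>w i. if w i then a i else 0"
  have near: "d (psum (?f w) (Suc n)) (cantor w) \<le> 2 * d (a (Suc n)) 0" for w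
    unfolding cantor_def by (rule psum_near_tsum[OF halving_a digit_small])
  have eq: "psum (?f w) n = psum (?f w') n" using assms(2) by (intro psum_cong) simp
  have "d (psum (?f w) (Suc n)) (psum (?f w') (Suc n)) = d (a n) 0"
  proof (cases "w n")
    case True
    then show ?thesis using assms(1) eq d_add_right by simp
  next
    case False
    then show ?thesis
      using assms(1) eq d_add_right[of "psum (?f w') n" "a n"] commute[of "psum (?f w') n"] by simp
  qed
  then show ?thesis
    using near[of w] near[of w'] d_triangle[of "cantor w" "cantor w'" "psum (?f w) (Suc n)"]
      d_triangle[of "psum (?f w) (Suc n)" "cantor w'" "psum (?f w') (Suc n)"]
      d_triangle[of "psum (?f w) (Suc n)" "psum (?f w') (Suc n)" "cantor w"]
      d_triangle[of "cantor w" "psum (?f w') (Suc n)" "cantor w'"]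
      commute[of "cantor w" "psum (?f w) (Suc n)"] commute[of "cantor w'" "psum (?f w') (Suc n)"]
    by linarith
qed

text \<open>If the first difference is at \<open>n\<close>, the error
  \<open>4 * d (a (Suc n)) 0\<close> is below \<open>d (a n) 0 / 24\<close>. So the distance is
  between 23/24 and 25/24 of \<open>d (a n) 0\<close>, whereas \<open>6 * \<delta> (Suc n)\<close>
  is a quarter of it and \<open>\<epsilon> n / 2\<close> more than twice it.\<close>

lemma cantor_gap_cantor:
  assumes "w \<noteq> w'"
  shows "cantor_gap (d (cantor w) (cantor w'))"
proof -
  obtain n where n: "w n \<noteq> w' n" "\<And>i. i < n \<Longrightarrow> w i = w' i"
    using exists_first_difference[OF assms] by blast
  show ?thesis
    unfolding cantor_gap_def
    using cantor_first_difference[of w n w', OF n] a_less[of "Suc n"] eps_le[of "Suc n"] delta_Suc[of n] a_less[of n] a_pos[of n] a_pos[of "Suc n"]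
    unfolding abs_le_iff by (intro exI[of _ n] conjI; linarith)
qed

lemma inj_cantor: "inj cantor"
proof (rule injI, rule ccontr)
  fix w w' assume "cantor w = cantor w'" "w \<noteq> w'"
  then have "cantor_gap 0" using cantor_gap_cantor[of w w'] by simp
  then show False using delta_pos by (auto simp: cantor_gap_def) (meson less_asym)
qed

section \<open>Codes, shifts and pieces\<close>

definition shift :: "(nat \<Rightarrow> table) \<Rightarrow> 'a" where
  "shift z = tsum (\<lambda>n. \<gamma> n (z n))"

text \<open>The tolerance \<open>\<delta> (Suc n)\<close> is chosen after
  \<open>\<epsilon> n\<close>, so it is too small to spoil the separation achieved by
  \<open>\<gamma> n\<close>.\<close>

definition codes :: "(nat \<Rightarrow> bool) \<Rightarrow> (nat \<Rightarrow> table) \<Rightarrow> 'a \<Rightarrow> bool" where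
  "codes \<alpha> z x \<longleftrightarrow> (\<forall>n. \<exists>i. table_val (z n) \<alpha> = Some i \<and> d (q i) x \<le> \<delta> (Suc n))"

definition piece :: "(nat \<Rightarrow> bool) \<Rightarrow> 'a set" where
  "piece \<alpha> = {shift z + x | z x. codes \<alpha> z x}"

lemma codesD:
  assumes "codes \<alpha> z x"
  obtains i where "table_val (z n) \<alpha> = Some i" "d (q i) x \<le> \<delta> (Suc n)"
  using assms unfolding codes_def by blast

lemma codes_near:
  assumes "codes \<alpha> z x" "codes \<alpha> z' x'" "z n = z' n"
  shows "d x x' \<le> 2 * \<delta> (Suc n)"
proof -
  obtain i where i: "table_val (z n) \<alpha> = Some i" "d (q i) x \<le> \<delta> (Suc n)"
    using codesD[OF assms(1)] by blast
  obtain j where j: "table_val (z' n) \<alpha> = Some j" "d (q j) x' \<le> \<delta> (Suc n)"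
    using codesD[OF assms(2)] by blast
  have "j = i" using i j assms(3) by simp
  then have "d (q i) x' \<le> \<delta> (Suc n)" using j(2) by simp
  then show ?thesis using i(2) d_triangle[of x x' "q i"] commute[of x "q i"] by linarith
qed

lemma codes_unique:
  assumes "codes \<alpha> z x" "codes \<alpha> z x'"
  shows "x = x'"
proof (rule ccontr)
  assume "x \<noteq> x'"
  then have "0 < d x x'" by simp
  then obtain n where "\<delta> n < d x x' / 2" using delta_small[of "d x x' / 2"] by auto
  moreover have "d x x' \<le> 2 * \<delta> (Suc n)" using codes_near[OF assms] by simp
  ultimately show False using delta_antimono[of n "Suc n"] by simp
qed

lemma shift_near: "(\<And>i. i < n \<Longrightarrow> z i = z' i) \<Longrightarrow> d (shift z) (shift z') \<le> 4 * \<delta> n"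
  unfolding shift_def by (rule tsum_near[OF halving_delta gamma_small gamma_small]) simp

text \<open>By left invariance the common part before \<open>n\<close> cancels and
  \<open>gamma_separated\<close> applies. On each side the tail of the shift costs
  \<open>2 * \<delta> (Suc n)\<close> and the approximation of the point
  \<open>\<delta> (Suc n)\<close>, far less than \<open>\<epsilon> n\<close> in total.\<close>

lemma codes_distance_lower:
  assumes c: "codes \<alpha> z x" "codes \<alpha> z' x'" and n: "z n \<noteq> z' n" "\<And>i. i < n \<Longrightarrow> z i = z' i"
  shows "\<epsilon> n / 2 < d (shift z + x) (shift z' + x')"
proof -
  let ?f = "\<lambda>z n. \<gamma> n (z n)"
  have near: "d (psum (?f z) (Suc n)) (shift z) \<le> 2 * \<delta> (Suc n)" for z
    unfolding shift_def by (rule psum_near_tsum[OF halving_delta gamma_small])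
  obtain i where i: "table_val (z n) \<alpha> = Some i" "d (q i) x \<le> \<delta> (Suc n)"
    using codesD[OF c(1)] by blast
  obtain j where j: "table_val (z' n) \<alpha> = Some j" "d (q j) x' \<le> \<delta> (Suc n)"
    using codesD[OF c(2)] by blast
  have eq: "psum (?f z) n = psum (?f z') n" using n(2) by (intro psum_cong) simp
  have "d (psum (?f z) (Suc n) + q i) (psum (?f z') (Suc n) + q j) =
      d (\<gamma> n (z n) + q i) (\<gamma> n (z' n) + q j)"
    by (simp add: eq add.assoc)
  then have "\<epsilon> n \<le> d (psum (?f z) (Suc n) + q i) (psum (?f z') (Suc n) + q j)"
    using gamma_separated[OF n(1) i(1) j(1)] by simp
  moreover have "d (psum (?f z) (Suc n) + q i) (shift z + x) \<le> 3 * \<delta> (Suc n)"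
    using d_add[of "psum (?f z) (Suc n)" "q i" "shift z" x] near[of z] i(2) by linarith
  moreover have "d (shift z' + x') (psum (?f z') (Suc n) + q j) \<le> 3 * \<delta> (Suc n)"
    using d_add[of "psum (?f z') (Suc n)" "q j" "shift z'" x'] near[of z'] j(2)
      commute[of "shift z' + x'" "psum (?f z') (Suc n) + q j"] by linarith
  ultimately show ?thesis
    using d_triangle[of "psum (?f z) (Suc n) + q i" "psum (?f z') (Suc n) + q j" "shift z + x"]
      d_triangle[of "shift z + x" "psum (?f z') (Suc n) + q j" "shift z' + x'"]
      delta_Suc_less[of n] eps_pos[of n] by linarith
qed

lemma codes_distance_upper:
  assumes c: "codes \<alpha> z x" "codes \<alpha> z' x'" and eq: "\<And>i. i < Suc n \<Longrightarrow> z i = z' i"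
  shows "d (shift z + x) (shift z' + x') \<le> 6 * \<delta> (Suc n)"
proof -
  have "d (shift z) (shift z') \<le> 4 * \<delta> (Suc n)" using eq by (rule shift_near)
  moreover have "d x x' \<le> 2 * \<delta> (Suc n)" using eq by (intro codes_near[OF c]) simp
  ultimately show ?thesis using d_add[of "shift z" x "shift z'" x'] by linarith
qed

text \<open>Suppose the distance is in gap \<open>m\<close>. The lower estimate excludes a first
  difference at or before \<open>m\<close>, and the upper estimate excludes one after
  \<open>m\<close>.\<close>

lemma piece_distance_not_gap:
  assumes "y \<in> piece \<alpha>" "y' \<in> piece \<alpha>" "cantor_gap (d y y')"
  shows False
proof -
  obtain z x where y: "y = shift z + x" and c: "codes \<alpha> z x" using assms(1) unfolding piece_def by blast
  obtain z' x' where y': "y' = shift z' + x'" and c': "codes \<alpha> z' x'" using assms(2) unfolding piece_def by blast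
  obtain m where m: "6 * \<delta> (Suc m) < d y y'" "d y y' < \<epsilon> m / 2" using assms(3) unfolding cantor_gap_def by blast
  show False
  proof (cases "z = z'")
    case True
    then have "y = y'" using codes_unique[of \<alpha> z x x'] c c' y y' by simp
    then show False using m delta_pos[of "Suc m"] by simp
  next
    case False
    obtain n where n: "z n \<noteq> z' n" "\<And>i. i < n \<Longrightarrow> z i = z' i"
      using exists_first_difference[OF False] by blast
    have "n > m" using codes_distance_lower[OF c c' n] eps_antimono[of n m] m y y' by force
    then have "d y y' \<le> 6 * \<delta> (Suc m)" unfolding y y' by (intro codes_distance_upper[OF c c'] n) simp
    then show False using m by simp
  qed
qed

lemma piece_meets_cantor:
  assumes "cantor w \<in> two_sided_translate g (piece \<alpha>) h" "cantor w' \<in> two_sided_translate g (piece \<alpha>) h"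
  shows "w = w'"
proof (rule ccontr)
  assume "w \<noteq> w'"
  obtain y y' where y: "y \<in> piece \<alpha>" "cantor w = g + y + h" "y' \<in> piece \<alpha>" "cantor w' = g + y' + h"
    using assms unfolding two_sided_translate_def by blast
  then have "d (cantor w) (cantor w') = d y y'" by simp
  then show False using piece_distance_not_gap[OF y(1,3)] cantor_gap_cantor[OF \<open>w \<noteq> w'\<close>] by simp
qed

lemma shift_tendsto:
  assumes "\<And>i. \<forall>\<^sub>F k in sequentially. Z k i = z i"
  shows "(\<lambda>k. shift (Z k)) \<longlonglongrightarrow> shift z"
  unfolding shift_def
proof (rule tsum_tendsto[OF halving_delta gamma_small gamma_small])
  show "\<forall>\<^sub>F k in sequentially. \<gamma> i (Z k i) = \<gamma> i (z i)" for i
    using assms[of i] by eventually_elim simp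
qed

lemma d_const_tendsto: "X \<longlonglongrightarrow> x \<Longrightarrow> (\<lambda>k. d c (X k)) \<longlonglongrightarrow> d c x"
  unfolding tendsto_iff_d[of X]
proof (rule Lim_transform_bound[of "\<lambda>k. d c (X k) - d c x" "\<lambda>k. d (X k) x" sequentially, THEN LIM_zero_cancel])
  show "\<forall>\<^sub>F k in sequentially. norm (d c (X k) - d c x) \<le> norm (d (X k) x)"
    using d_triangle[of c _ x] d_triangle[of c x] commute[of x] by (intro always_eventually) (smt (verit) real_norm_def)
qed

text \<open>A table reads finitely many bits, so its value is eventually constant, and the distance
  condition passes to the limit.\<close>

lemma codes_limit:
  assumes c: "\<And>k. codes (\<beta> k) (Z k) (x k)" and x: "x \<longlonglongrightarrow> x'"
    and ev: "\<And>i. \<forall>\<^sub>F k in sequentially. Z k i = z i" and ev': "\<And>i. \<forall>\<^sub>F k in sequentially. \<beta> k i = \<beta>' i"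
  shows "codes \<beta>' z x'"
  unfolding codes_def
proof
  fix n
  have "\<forall>\<^sub>F k in sequentially. \<forall>i\<in>{..<fst (z n)}. \<beta> k i = \<beta>' i"
    using ev' by (intro eventually_ball_finite) auto
  then have val: "\<forall>\<^sub>F k in sequentially. table_val (Z k n) (\<beta> k) = table_val (z n) \<beta>'"
    using ev[of n] by eventually_elim (auto intro: table_val_cong)
  then obtain k where "table_val (Z k n) (\<beta> k) = table_val (z n) \<beta>'"
    unfolding eventually_sequentially by blast
  then obtain i where i: "table_val (z n) \<beta>' = Some i" using codesD[OF c[of k], of n] by metis
  have "\<forall>\<^sub>F k in sequentially. d (q i) (x k) \<le> \<delta> (Suc n)"
    using val
  proof eventually_elim
    case (elim k)
    then show ?case using codesD[OF c[of k], of n] i by (metis option.inject)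
  qed
  then have "d (q i) x' \<le> \<delta> (Suc n)"
    using tendsto_upperbound[OF d_const_tendsto[OF x]] by simp
  then show "\<exists>i. table_val (z n) \<beta>' = Some i \<and> d (q i) x' \<le> \<delta> (Suc n)" using i by blast
qed

text \<open>By \<open>codes_distance_lower\<close>, nearby points of a piece have codes with a long
  common initial part. The codes of a convergent sequence therefore stabilise, their shifts
  converge, and so do the coded values.\<close>

lemma closed_piece: "closed (piece \<alpha>)"
  unfolding closed_sequential_limits
proof (intro allI impI, elim conjE)
  fix y :: "nat \<Rightarrow> 'a" and l assume "\<forall>n. y n \<in> piece \<alpha>" and l: "y \<longlonglongrightarrow> l"
  then have "\<forall>k. \<exists>z x. y k = shift z + x \<and> codes \<alpha> z x" unfolding piece_def by blast
  then obtain Z x where y: "\<And>k. y k = shift (Z k) + x k" and c: "\<And>k. codes \<alpha> (Z k) (x k)" by metis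
  have "\<exists>N. \<forall>k\<ge>N. \<forall>k'\<ge>N. Z k n = Z k' n" for n
  proof -
    obtain N where N: "\<And>k. k \<ge> N \<Longrightarrow> d (y k) l < \<epsilon> n / 4"
      using l eps_pos[of n] unfolding tendsto_iff_d_less by (metis divide_pos_pos zero_less_numeral)
    have "Z k n = Z k' n" if "k \<ge> N" "k' \<ge> N" for k k'
    proof (rule ccontr)
      assume ne: "Z k n \<noteq> Z k' n"
      then have "Z k \<noteq> Z k'" by auto
      then obtain m where m: "Z k m \<noteq> Z k' m" "\<And>i. i < m \<Longrightarrow> Z k i = Z k' i"
        using exists_first_difference by blast
      have "m \<le> n" using ne m(2) by (meson not_le)
      have "\<epsilon> m / 2 < d (y k) (y k')" unfolding y by (rule codes_distance_lower[OF c c m])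
      moreover have "d (y k) (y k') < \<epsilon> n / 2"
        using N[OF that(1)] N[OF that(2)] d_triangle[of "y k" "y k'" l] commute[of l "y k'"] by linarith
      ultimately show False using eps_antimono[OF \<open>m \<le> n\<close>] by linarith
    qed
    then show ?thesis by blast
  qed
  then obtain N where N: "\<And>n k k'. k \<ge> N n \<Longrightarrow> k' \<ge> N n \<Longrightarrow> Z k n = Z k' n" by metis
  define z where "z n = Z (N n) n" for n
  have ev: "\<forall>\<^sub>F k in sequentially. Z k n = z n" for n
    unfolding eventually_sequentially z_def using N[of n] by blast
  have "x = (\<lambda>k. - shift (Z k) + y k)" by (simp add: y fun_eq_iff)
  moreover have "(\<lambda>k. - shift (Z k) + y k) \<longlonglongrightarrow> - shift z + l"
    by (intro tendsto_add tendsto_minus shift_tendsto ev l)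
  ultimately have "x \<longlonglongrightarrow> - shift z + l" by simp
  then have "codes \<alpha> z (- shift z + l)" by (rule codes_limit[where \<beta> = "\<lambda>_. \<alpha>", OF c _ ev]) simp
  moreover have "l = shift z + (- shift z + l)" by simp
  ultimately show "l \<in> piece \<alpha>" unfolding piece_def by blast
qed

lemma exists_codes_limit:
  assumes c: "\<And>k. codes (\<beta> k) (Z k) (x k)"
    and ev: "\<And>i. \<forall>\<^sub>F k in sequentially. Z k i = z i" and ev': "\<And>i. \<forall>\<^sub>F k in sequentially. \<beta> k i = \<beta>' i"
  shows "\<exists>x'. x \<longlonglongrightarrow> x'"
proof (rule d_Cauchy_convergent)
  fix e :: real assume "e > 0"
  then obtain n where n: "\<delta> n < e / 2" using delta_small[of "e / 2"] by auto
  have "\<forall>\<^sub>F k in sequentially. \<forall>i\<in>{..<fst (z n)}. \<beta> k i = \<beta>' i"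
    using ev' by (intro eventually_ball_finite) auto
  then have "\<forall>\<^sub>F k in sequentially. table_val (Z k n) (\<beta> k) = table_val (z n) \<beta>'"
    using ev[of n] by eventually_elim (auto intro: table_val_cong)
  then obtain N where N: "\<And>k. k \<ge> N \<Longrightarrow> table_val (Z k n) (\<beta> k) = table_val (z n) \<beta>'"
    unfolding eventually_sequentially by blast
  obtain i where i: "table_val (z n) \<beta>' = Some i" using codesD[OF c[of N], of n] N[OF order_refl] by auto
  have near: "d (q i) (x k) < e / 2" if "k \<ge> N" for k
  proof -
    obtain j where "table_val (Z k n) (\<beta> k) = Some j" "d (q j) (x k) \<le> \<delta> (Suc n)"
      using codesD[OF c[of k], of n] by blast
    then show ?thesis using N[OF that] i n delta_antimono[of n "Suc n"] by simp
  qed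
  have "d (x k) (x k') < e" if "k \<ge> N" "k' \<ge> N" for k k'
    using near[OF that(1)] near[OF that(2)] d_triangle[of "x k" "x k'" "q i"] commute[of "x k" "q i"] by linarith
  then show "\<exists>N. \<forall>m\<ge>N. \<forall>n\<ge>N. d (x m) (x n) < e" by blast
qed

text \<open>The condition \<open>piece \<alpha> \<subseteq> B\<close> is coanalytic in \<alpha>. The
  tables obtained from its perfect set of solutions are themselves taken as a code, and the shift of
  that code is the translation \<open>t\<close>.\<close>

lemma large_borel_contains_translates:
  assumes B: "B \<in> sets borel" and large: "\<not> |{\<alpha>. piece \<alpha> \<subseteq> B}| \<le>o omega1" and C: "compact C"
  shows "\<exists>t. (+) t ` C \<subseteq> B"
proof -
  have "suslin (- B)" using B by (intro suslin_borel) auto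
  then obtain R where R: "seq_closed R" "\<And>y. y \<notin> B \<longleftrightarrow> (\<exists>w. R y w)"
    unfolding suslin_def by auto
  \<comment> \<open>The coordinates are \<alpha>, a code and a witness that the point is outside
    \<open>B\<close>. The value \<open>x\<close> is only quantified: it converges whenever \<alpha>
    and the code do, so \<open>S\<close> is closed.\<close>
  define S :: "(nat \<Rightarrow> bool \<times> table \<times> nat) set" where
    "S = {y. \<exists>x. codes (fst \<circ> y) (fst \<circ> snd \<circ> y) x \<and> R (shift (fst \<circ> snd \<circ> y) + x) (snd \<circ> snd \<circ> y)}"
  have S_iff: "(\<forall>y\<in>S. fst \<circ> y \<noteq> \<alpha>) \<longleftrightarrow> piece \<alpha> \<subseteq> B" for \<alpha>
  proof
    assume S: "\<forall>y\<in>S. fst \<circ> y \<noteq> \<alpha>"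
    show "piece \<alpha> \<subseteq> B"
    proof (rule ccontr)
      assume "\<not> piece \<alpha> \<subseteq> B"
      then obtain z x where "codes \<alpha> z x" "shift z + x \<notin> B"
        unfolding piece_def by blast
      then obtain w where zxw: "codes \<alpha> z x" "R (shift z + x) w"
        using R(2) by blast
      let ?y = "\<lambda>n. (\<alpha> n, z n, w n)"
      have "fst \<circ> ?y = \<alpha>" "fst \<circ> snd \<circ> ?y = z" "snd \<circ> snd \<circ> ?y = w" by auto
      then have "?y \<in> S" using zxw unfolding S_def by (simp only: mem_Collect_eq) blast
      then show False using S \<open>fst \<circ> ?y = \<alpha>\<close> by blast
    qed
  next
    assume "piece \<alpha> \<subseteq> B"
    then show "\<forall>y\<in>S. fst \<circ> y \<noteq> \<alpha>"
      using R(2) unfolding S_def piece_def by blast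
  qed
  have closed: "finitely_closed S"
    unfolding finitely_closed_def
  proof (intro allI impI)
    fix y assume y: "\<forall>n. \<exists>y'\<in>S. \<forall>i<n. y' i = y i"
    then obtain Y where Y: "\<And>k. Y k \<in> S" "\<And>k i. i < k \<Longrightarrow> Y k i = y i" by metis
    have ev: "\<forall>\<^sub>F k in sequentially. Y k i = y i" for i
      unfolding eventually_sequentially using Y(2) by (intro exI[of _ "Suc i"]) auto
    have "\<forall>k. \<exists>x. codes (fst \<circ> Y k) (fst \<circ> snd \<circ> Y k) x \<and> R (shift (fst \<circ> snd \<circ> Y k) + x) (snd \<circ> snd \<circ> Y k)"
      using Y(1) unfolding S_def by blast
    then obtain x where x: "\<And>k. codes (fst \<circ> Y k) (fst \<circ> snd \<circ> Y k) (x k)"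
      "\<And>k. R (shift (fst \<circ> snd \<circ> Y k) + x k) (snd \<circ> snd \<circ> Y k)" by metis
    have ev1: "\<forall>\<^sub>F k in sequentially. (fst \<circ> snd \<circ> Y k) i = (fst \<circ> snd \<circ> y) i" for i
      using ev[of i] by eventually_elim simp
    have ev2: "\<forall>\<^sub>F k in sequentially. (fst \<circ> Y k) i = (fst \<circ> y) i" for i
      using ev[of i] by eventually_elim simp
    have ev3: "\<forall>\<^sub>F k in sequentially. (snd \<circ> snd \<circ> Y k) i = (snd \<circ> snd \<circ> y) i" for i
      using ev[of i] by eventually_elim simp
    obtain x' where x': "x \<longlonglongrightarrow> x'" using exists_codes_limit[OF x(1) ev1 ev2] by blast
    have "codes (fst \<circ> y) (fst \<circ> snd \<circ> y) x'" by (rule codes_limit[OF x(1) x' ev1 ev2])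
    moreover have "R (shift (fst \<circ> snd \<circ> y) + x') (snd \<circ> snd \<circ> y)"
      by (rule seq_closedD[OF R(1) x(2) _ ev3]) (intro tendsto_add x' shift_tendsto ev1)
    ultimately show "y \<in> S" unfolding S_def by blast
  qed
  \<comment> \<open>Compactness gives finite nets of \<open>C\<close> inside the dense sequence;
    their indices are the values that the tables have to produce.\<close>
  have "\<exists>N. finite N \<and> (\<forall>x\<in>C. \<exists>i\<in>N. d (q i) x < e)" if e: "e > 0" for e
  proof -
    have "\<And>i. open {x. d (q i) x < e}" by (rule open_d_ball)
    moreover have "C \<subseteq> (\<Union>i\<in>UNIV. {x. d (q i) x < e})" using q_dense[OF e] by blast
    ultimately obtain N where "finite N" "C \<subseteq> (\<Union>i\<in>N. {x. d (q i) x < e})"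
      using compactE_image[OF C, of UNIV "\<lambda>i. {x. d (q i) x < e}"] by auto
    then show ?thesis by blast
  qed
  then have "\<forall>n. \<exists>N. finite N \<and> (\<forall>x\<in>C. \<exists>i\<in>N. d (q i) x < \<delta> (Suc n))" using delta_pos by blast
  then obtain N where N: "\<And>n. finite (N n)" "\<And>n x. x \<in> C \<Longrightarrow> \<exists>i\<in>N n. d (q i) x < \<delta> (Suc n)" by metis
  have "\<not> |{\<alpha>. \<forall>y\<in>S. fst \<circ> y \<noteq> \<alpha>}| \<le>o omega1" using large by (simp only: S_iff not_False_eq_True)
  then obtain \<tau> where "\<forall>c. (\<forall>n. c n \<in> N n) \<longrightarrow>
      (\<exists>\<alpha>. (\<forall>y\<in>S. fst \<circ> y \<noteq> \<alpha>) \<and> (\<forall>n. table_val (\<tau> n) \<alpha> = Some (c n)))"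
    using coprojection_perfect_table[where N = N, OF closed _ N(1)] by blast
  then have \<tau>: "\<And>c. (\<forall>n. c n \<in> N n) \<Longrightarrow>
      \<exists>\<alpha>. piece \<alpha> \<subseteq> B \<and> (\<forall>n. table_val (\<tau> n) \<alpha> = Some (c n))"
    unfolding S_iff by blast
  have "shift \<tau> + x \<in> B" if x: "x \<in> C" for x
  proof -
    have "\<forall>n. \<exists>i. i \<in> N n \<and> d (q i) x < \<delta> (Suc n)" using N(2)[OF x] by blast
    then obtain c where c: "\<And>n. c n \<in> N n" "\<And>n. d (q (c n)) x < \<delta> (Suc n)" by metis
    then obtain \<alpha> where \<alpha>: "piece \<alpha> \<subseteq> B" "\<And>n. table_val (\<tau> n) \<alpha> = Some (c n)"
      using \<tau>[of c] by blast
    \<comment> \<open>The same \<tau> codes every point of \<open>C\<close>; only \<alpha> depends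
      on the point.\<close>
    have "codes \<alpha> \<tau> x" unfolding codes_def using \<alpha>(2) c(2) by (auto intro: less_imp_le)
    then show ?thesis using \<alpha>(1) unfolding piece_def by blast
  qed
  then show ?thesis by blast
qed

end

section \<open>Cofinality\<close>

context tsi_scheme
begin

lemma countable_cantor_preimage: "countable T \<Longrightarrow> countable {w. cantor w \<in> T}"
  using countable_image_inj_on[of cantor "{w. cantor w \<in> T}"] inj_cantor
  by (metis (mono_tags, lifting) countable_subset image_subsetI inj_on_subset mem_Collect_eq subset_UNIV)

text \<open>Common to both ideals: \<open>hull\<close> makes each member of a cofinal family contain
  few pieces, and \<open>small\<close> puts all pieces and all countable sets into the
  ideal.\<close>

lemma cof_eq_continuum:
  fixes P :: "'a set \<Rightarrow> bool"
  assumes hull: "\<And>X. P X \<Longrightarrow> \<exists>B\<in>sets borel. X \<subseteq> B \<and> P B \<and> (\<exists>C. compact C \<and> (\<forall>t. \<not> (+) t ` C \<subseteq> B))"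
    and small: "\<And>B. B \<in> sets borel \<Longrightarrow>
      (\<And>g h. countable {w. cantor w \<in> two_sided_translate g B h}) \<Longrightarrow> P B"
  shows "cof {X. P X} =o ( |UNIV :: (nat \<Rightarrow> bool) set| )"
proof -
  let ?c = "|UNIV :: (nat \<Rightarrow> bool) set|"
  note min = cof_minimum[of "{X. P X}"]
  define avoids where "avoids B \<longleftrightarrow> (\<exists>C. compact C \<and> (\<forall>t. \<not> (+) t ` C \<subseteq> B))" for B :: "'a set"
  have hull': "\<exists>B\<in>sets borel. X \<subseteq> B \<and> P B \<and> avoids B" if "P X" for X
    unfolding avoids_def using that by (rule hull)
  have "cofinal_subfamily {X. P X} {B \<in> sets borel. P B}"
    unfolding cofinal_subfamily_def using hull' by blast
  then have "cof {X. P X} \<le>o |{B \<in> sets borel. P B}|" using min by blast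
  also have "|{B \<in> sets borel. P B}| \<le>o |sets (borel :: 'a measure)|"
    by (rule card_of_mono1) blast
  also have "|sets (borel :: 'a measure)| \<le>o ?c" by (rule card_of_borel_sets)
  finally have upper: "cof {X. P X} \<le>o ?c" .
  obtain \<A> where \<A>: "cofinal_subfamily {X. P X} \<A>" "cof {X. P X} = |\<A>|"
    using conjunct1[OF min] by (elim CollectE exE conjE)
  have "\<forall>A\<in>\<A>. \<exists>B. B \<in> sets borel \<and> A \<subseteq> B \<and> avoids B"
  proof
    fix A assume "A \<in> \<A>"
    then have "P A" using \<A>(1) unfolding cofinal_subfamily_def by blast
    then show "\<exists>B. B \<in> sets borel \<and> A \<subseteq> B \<and> avoids B" using hull' by blast
  qed
  from bchoice[OF this] obtain H where "\<forall>A\<in>\<A>. H A \<in> sets borel \<and> A \<subseteq> H A \<and> avoids (H A)" ..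
  then have H: "H A \<in> sets borel" "A \<subseteq> H A" "avoids (H A)" if "A \<in> \<A>" for A
    using that by auto
  have cover: "\<exists>A\<in>\<A>. X \<subseteq> H A" if X: "P X" for X
  proof -
    obtain A where A: "A \<in> \<A>" "X \<subseteq> A"
      using X \<A>(1) unfolding cofinal_subfamily_def by blast
    then show ?thesis using H(2)[OF A(1)] by blast
  qed
  define Z where "Z A = {\<alpha>. piece \<alpha> \<subseteq> H A}" for A
  have Z: "|Z A| \<le>o omega1" if "A \<in> \<A>" for A
    using large_borel_contains_translates[OF H(1)[OF that]] H(3)[OF that] unfolding Z_def avoids_def by blast
  have "P (piece \<alpha>)" for \<alpha>
  proof (rule small)
    show "piece \<alpha> \<in> sets borel" using closed_piece by (rule borel_closed)
    fix g h
    show "countable {w. cantor w \<in> two_sided_translate g (piece \<alpha>) h}"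
    proof (cases "{w. cantor w \<in> two_sided_translate g (piece \<alpha>) h} = {}")
      case False
      then obtain w where "cantor w \<in> two_sided_translate g (piece \<alpha>) h" by blast
      then have "{w. cantor w \<in> two_sided_translate g (piece \<alpha>) h} \<subseteq> {w}"
        using piece_meets_cantor by blast
      then show ?thesis using countable_subset by blast
    qed simp
  qed
  then have UN: "(UNIV :: (nat \<Rightarrow> bool) set) = (\<Union>A\<in>\<A>. Z A)"
    using cover unfolding Z_def by blast
  have "?c \<le>o |\<A>|"
  proof (rule ccontr)
    assume "\<not> ?c \<le>o |\<A>|"
    then have less: "|\<A>| <o ?c" by (rule not_ordLeq_iff_ordLess[OF card_of_Well_order card_of_Well_order, THEN iffD1])
    \<comment> \<open>Above \<open>omega1\<close> the union of the \<open>Z A\<close> has at most as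
      many elements as the family. Otherwise the continuum is at most \<open>omega1\<close>, and the
      family, being smaller, is countable.\<close>
    show False
    proof (cases "|\<A>| \<le>o omega1")
      case False
      then have le: "omega1 \<le>o |\<A>|"
        using omega1_Cinfinite by (meson card_of_Well_order card_order_on_well_order_on ordLeq_total)
      then have "Cinfinite |\<A>|"
        using omega1_Cinfinite cinfinite_mono card_of_Card_order by blast
      then have "|\<Union>A\<in>\<A>. Z A| \<le>o |\<A>|"
        using Z le ordLeq_transitive by (intro UNION_Cinfinite_bound) (auto intro: ordLeq_refl)
      then show False using less unfolding UN[symmetric] using not_ordLess_ordLeq by blast
    next
      case True
      then have "?c \<le>o omega1"
        unfolding UN using Z by (intro UNION_Cinfinite_bound omega1_Cinfinite) auto
      then have "|\<A>| <o omega1" using less ordLess_ordLeq_trans by blast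
      then have "|\<A>| \<le>o natLeq"
        using cardSuc_ordLeq_ordLess[OF natLeq_Card_order card_of_Card_order] by blast
      then have "countable \<A>" by (simp add: countable_card_le_natLeq)
      \<comment> \<open>Choosing a point outside each hull gives a countable set, hence a set in the
        ideal, that no hull contains.\<close>
      have "\<forall>A\<in>\<A>. \<exists>x. x \<notin> H A" using H(3) unfolding avoids_def by blast
      then obtain x where x: "\<And>A. A \<in> \<A> \<Longrightarrow> x A \<notin> H A" by metis
      have count: "countable (x ` \<A>)" using \<open>countable \<A>\<close> by simp
      have "P (x ` \<A>)"
      proof (rule small)
        have "x ` \<A> = (\<Union>y\<in>x ` \<A>. {y})" by blast
        moreover have "(\<Union>y\<in>x ` \<A>. {y}) \<in> sets borel"
          by (rule sets.countable_UN'[OF count]) (auto intro: borel_closed)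
        ultimately show "x ` \<A> \<in> sets borel" by simp
        show "countable {w. cantor w \<in> two_sided_translate g (x ` \<A>) h}" for g h
          unfolding two_sided_translate_def by (rule countable_cantor_preimage[OF countable_image[OF count]])
      qed
      then show False using cover[of "x ` \<A>"] x by blast
    qed
  qed
  then show ?thesis using upper \<A>(2) by (simp add: ordIso_iff_ordLeq)
qed

end

section \<open>Borel hulls that contain no translate of some compact set\<close>

lemma haar_null_hull:
  fixes X :: "'a::{polish_space,topological_group_add} set"
  assumes "haar_null X"
  shows "\<exists>B\<in>sets borel. X \<subseteq> B \<and> haar_null B \<and> (\<exists>C. compact C \<and> (\<forall>t. \<not> (+) t ` C \<subseteq> B))"
proof -
  obtain \<mu> :: "'a measure" and B where \<mu>: "B \<in> sets borel" "sets \<mu> = sets borel" "emeasure \<mu> (space \<mu>) = 1"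
    "X \<subseteq> B" "\<And>g h. emeasure \<mu> (two_sided_translate g B h) = 0"
    using assms unfolding haar_null_def by blast
  have "space \<mu> = UNIV" using sets_eq_imp_space_eq[OF \<mu>(2)] by simp
  \<comment> \<open>Inner regularity yields a compact set of positive measure. A translate of it
    inside \<open>B\<close> would place it inside a translate of \<open>B\<close>, which is
    null.\<close>
  then have "(SUP K\<in>{K. K \<subseteq> UNIV \<and> compact K}. emeasure \<mu> K) = 1"
    using inner_regular[OF \<mu>(2), of UNIV] \<mu>(3) by simp
  moreover have "0 < (1 :: ennreal)" by simp
  ultimately have "0 < (SUP K\<in>{K. K \<subseteq> UNIV \<and> compact K}. emeasure \<mu> K)" by (simp only:)
  then obtain C where C: "compact C" "0 < emeasure \<mu> C"
    unfolding less_SUP_iff by blast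
  have "\<not> (+) t ` C \<subseteq> B" for t
  proof
    assume "(+) t ` C \<subseteq> B"
    then have "C \<subseteq> two_sided_translate (- t) B 0"
      unfolding two_sided_translate_def by (force simp: image_iff)
    then have "emeasure \<mu> C \<le> emeasure \<mu> (two_sided_translate (- t) B 0)"
      using two_sided_translate_borel[OF \<mu>(1)] by (intro emeasure_mono) (simp_all add: \<mu>(2))
    then show False using C(2) \<mu>(5) by simp
  qed
  moreover have "haar_null B"
    unfolding haar_null_def using \<mu> by blast
  ultimately show ?thesis using \<mu>(1,4) C(1) by blast
qed

lemma haar_meager_hull:
  fixes X :: "'a::{polish_space,topological_group_add} set"
  assumes "haar_meager X"
  shows "\<exists>B\<in>sets borel. X \<subseteq> B \<and> haar_meager B \<and> (\<exists>C. compact C \<and> (\<forall>t. \<not> (+) t ` C \<subseteq> B))"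
proof -
  obtain K :: "real set" and d f B where W: "haar_meager_witness K d f B X"
    using assms unfolding haar_meager_def by blast
  interpret K: Metric_space K d using W unfolding haar_meager_witness_def by blast
  have W': "K \<noteq> {}" "compact_space K.mtopology" "continuous_map K.mtopology euclidean f" "B \<in> sets borel" "X \<subseteq> B"
    "\<And>g h. meager_in K.mtopology {x \<in> K. f x \<in> two_sided_translate g B h}"
    using W unfolding haar_meager_witness_def by auto
  have "compactin K.mtopology K" using W'(2) by (simp add: compact_space_def)
  then have C: "compact (f ` K)"
    using image_compactin[OF _ W'(3)] by simp
  have "\<not> (+) t ` f ` K \<subseteq> B" for t
  proof
    assume t: "(+) t ` f ` K \<subseteq> B"
    have "{x \<in> K. f x \<in> two_sided_translate (- t) B 0} = K"
    proof -
      have "f x \<in> two_sided_translate (- t) B 0" if "x \<in> K" for x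
        unfolding two_sided_translate_def using t that by (intro image_eqI[of _ _ "t + f x"]) auto
      then show ?thesis by blast
    qed
    then have "meager_in K.mtopology K" using W'(6)[of "- t" 0] by simp
    then obtain \<N> where \<N>: "countable \<N>" "\<And>N. N \<in> \<N> \<Longrightarrow> nowhere_dense_in K.mtopology N" "K = \<Union>\<N>"
      unfolding meager_in_def by blast
    let ?\<G> = "(\<lambda>N. K.mtopology closure_of N) ` \<N>"
    have "K.mtopology interior_of \<Union>?\<G> = {}"
    proof (rule K.metric_Baire_category_alt)
      show K.mcomplete using W'(2) by (rule K.compact_space_imp_mcomplete)
      show "countable ?\<G>" using \<N>(1) by simp
      show "closedin K.mtopology T \<and> K.mtopology interior_of T = {}" if "T \<in> ?\<G>" for T
        using that \<N>(2) unfolding nowhere_dense_in_def by auto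
    qed
    moreover have "\<Union>?\<G> = K"
    proof
      show "\<Union>?\<G> \<subseteq> K" using closure_of_subset_topspace[of K.mtopology] by auto
      have "N \<subseteq> K.mtopology closure_of N" if "N \<in> \<N>" for N
        using that \<N>(3) K.topspace_mtopology by (intro closure_of_subset) blast
      then show "K \<subseteq> \<Union>?\<G>" using \<N>(3) by blast
    qed
    moreover have "K.mtopology interior_of K = K"
      using interior_of_topspace[of K.mtopology] by simp
    ultimately show False using W'(1) by simp
  qed
  moreover have "haar_meager B"
    using W by (intro haar_meagerI[of K d f B]) (auto simp: haar_meager_witness_def)
  ultimately show ?thesis using W'(4,5) C by blast
qed

section \<open>Smallness tested on the Cantor set\<close>

lemma compact_UNIV_bool_sequences: "compact (UNIV :: (nat \<Rightarrow> bool) set)"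
proof -
  have "compact_space (euclidean :: bool topology)"
    by (simp add: compact_space_def finite_imp_compact)
  then have "compact_space (product_topology (\<lambda>_ :: nat. euclidean :: bool topology) UNIV)"
    by (simp add: compact_space_product_topology)
  then show ?thesis
    unfolding euclidean_product_topology by (simp add: compact_space_def)
qed

definition digits :: "real \<Rightarrow> nat \<Rightarrow> bool" where
  "digits x n = odd \<lfloor>2 ^ Suc n * x\<rfloor>"

text \<open>Equal digits give equal integer parts of \<open>2 ^ n * x\<close> and
  \<open>2 ^ n * y\<close> for all \<open>n\<close>, so the points differ by less than every power
  of 1/2.\<close>

lemma inj_on_digits: "inj_on digits {0..<1}"
proof (rule inj_onI, rule ccontr)
  fix x y :: real assume x: "x \<in> {0..<1}" and y: "y \<in> {0..<1}" and eq: "digits x = digits y" and "x \<noteq> y"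
  have "\<lfloor>2 ^ n * x\<rfloor> = \<lfloor>2 ^ n * y\<rfloor>" for n
  proof (induction n)
    case 0
    have "\<lfloor>x\<rfloor> = 0" "\<lfloor>y\<rfloor> = 0" using x y by (auto simp: floor_eq_iff)
    then show ?case by simp
  next
    case (Suc n)
    have step: "\<lfloor>2 ^ Suc n * u\<rfloor> div 2 = \<lfloor>2 ^ n * u\<rfloor>" for u :: real
      using floor_divide_real_eq_div[of 2 "2 ^ Suc n * u"] by simp
    have "even \<lfloor>2 ^ Suc n * x\<rfloor> = even \<lfloor>2 ^ Suc n * y\<rfloor>"
      using fun_cong[OF eq, of n] unfolding digits_def by argo
    then show ?case using step[of x] step[of y] Suc by (smt (verit) div_mult_mod_eq parity_cases)
  qed
  then have close: "2 ^ n * \<bar>x - y\<bar> < 1" for n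
  proof -
    have "\<bar>2 ^ n * x - 2 ^ n * y\<bar> < 1"
      using \<open>\<And>n. \<lfloor>2 ^ n * x\<rfloor> = \<lfloor>2 ^ n * y\<rfloor>\<close>[of n] by linarith
    also have "\<bar>2 ^ n * x - 2 ^ n * y\<bar> = 2 ^ n * \<bar>x - y\<bar>"
      by (simp add: right_diff_distrib[symmetric] abs_mult)
    finally show ?thesis .
  qed
  obtain n where "1 / \<bar>x - y\<bar> < 2 ^ n" using real_arch_pow[of 2 "1 / \<bar>x - y\<bar>"] by auto
  then show False using close[of n] \<open>x \<noteq> y\<close> by (simp add: field_simps)
qed

context tsi_scheme
begin

lemma measurable_cantor_digits: "(\<lambda>x. cantor (digits x)) \<in> borel_measurable borel"
proof (rule borel_measurable_LIMSEQ_metric)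
  let ?f = "\<lambda>x i. if digits x i then a i else 0"
  have "(\<lambda>x. ?f x i) \<in> borel_measurable borel" for i
    unfolding digits_def by measurable
  then show "(\<lambda>x. psum (?f x) n) \<in> borel_measurable borel" for n
    by (induction n) auto
  show "(\<lambda>n. psum (?f x) n) \<longlonglongrightarrow> cantor (digits x)" for x
    unfolding cantor_def by (rule psum_tendsto[OF halving_a digit_small])
qed

text \<open>The witness is the image of Lebesgue measure on the unit interval under binary digits
  followed by \<open>cantor\<close>. Injectivity of \<open>digits\<close> turns countable sets of
  codes into countable, hence null, sets of reals.\<close>

lemma small_imp_haar_null:
  assumes B: "B \<in> sets borel" and count: "\<And>g h. countable {w. cantor w \<in> two_sided_translate g B h}"
  shows "haar_null B"
proof -
  let ?I = "restrict_space lborel {0..<1::real}"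
  let ?f = "\<lambda>x. cantor (digits x)"
  define \<mu> where "\<mu> = distr ?I borel ?f"
  have f: "?f \<in> measurable ?I borel"
    using measurable_cantor_digits by (intro measurable_restrict_space1) simp
  have em: "emeasure \<mu> T = emeasure lborel {x \<in> {0..<1}. ?f x \<in> T}" if "T \<in> sets borel" for T
  proof -
    have "emeasure \<mu> T = emeasure ?I (?f -` T \<inter> space ?I)"
      unfolding \<mu>_def using f that by (rule emeasure_distr)
    also have "?f -` T \<inter> space ?I = {x \<in> {0..<1}. ?f x \<in> T}" by (auto simp: space_restrict_space)
    also have "emeasure ?I \<dots> = emeasure lborel {x \<in> {0..<1}. ?f x \<in> T}"
      by (rule emeasure_restrict_space) auto
    finally show ?thesis .
  qed
  have "emeasure \<mu> (two_sided_translate g B h) = 0" for g h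
  proof -
    have "countable {x \<in> {0..<1}. ?f x \<in> two_sided_translate g B h}"
    proof (rule countable_image_inj_on)
      show "inj_on digits {x \<in> {0..<1}. ?f x \<in> two_sided_translate g B h}"
        using inj_on_digits by (rule inj_on_subset) auto
      show "countable (digits ` {x \<in> {0..<1}. ?f x \<in> two_sided_translate g B h})"
        using count[of g h] by (rule countable_subset[rotated]) auto
    qed
    then show ?thesis
      using em[OF two_sided_translate_borel[OF B]] by (simp add: emeasure_lborel_countable)
  qed
  moreover have "emeasure \<mu> (space \<mu>) = 1"
  proof -
    have "{x. 0 \<le> x \<and> x < 1} = {0..<1::real}" by auto
    then show ?thesis using em[of UNIV] by (simp add: \<mu>_def)
  qed
  moreover have "sets \<mu> = sets borel" by (simp add: \<mu>_def)
  ultimately show ?thesis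
    unfolding haar_null_def using B by blast
qed

lemma continuous_cantor: "continuous_on UNIV cantor"
proof -
  have "open (cantor -` U)" if U: "open U" for U
  proof (subst open_subopen, intro ballI)
    fix w assume "w \<in> cantor -` U"
    then obtain s where s: "s > 0" "\<And>y. d (cantor w) y < s \<Longrightarrow> y \<in> U"
      using open_contains_d_ball[OF U] by auto
    obtain n where n: "d (a n) 0 < s / 4" using halving_small[OF halving_a, of "s / 4"] s(1) by auto
    let ?V = "\<Inter>i\<in>{..<n}. (\<lambda>v :: nat \<Rightarrow> bool. v i) -` {w i}"
    have "open ((\<lambda>v :: nat \<Rightarrow> bool. v i) -` {w i})" for i
      by (intro open_vimage open_discrete continuous_on_product_coordinates)
    then have "open ?V" by (intro open_INT) auto
    moreover have "?V \<subseteq> cantor -` U"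
    proof
      fix v assume "v \<in> ?V"
      then have "d (cantor w) (cantor v) \<le> 4 * d (a n) 0" by (intro cantor_near) auto
      then show "v \<in> cantor -` U" using n s(2) by simp
    qed
    ultimately show "\<exists>T. open T \<and> w \<in> T \<and> T \<subseteq> cantor -` U" by (intro exI[of _ ?V]) auto
  qed
  then show ?thesis by (simp add: continuous_on_open_vimage)
qed

text \<open>The Cantor set has no isolated point: changing one late digit gives another point
  arbitrarily near.\<close>

lemma singleton_nowhere_dense_in_cantor:
  assumes "p \<in> range cantor"
  shows "nowhere_dense_in (top_of_set (range cantor)) {p}"
proof -
  let ?T = "top_of_set (range cantor)"
  have "closedin ?T {p}"
    using assms unfolding closedin_closed by (intro exI[of _ "{p}"]) auto
  then have "?T closure_of {p} = {p}" by (simp add: closure_of_eq)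
  moreover have "?T interior_of {p} = {}"
  proof (rule ccontr)
    assume "?T interior_of {p} \<noteq> {}"
    moreover have "?T interior_of {p} \<subseteq> {p}" by (rule interior_of_subset)
    ultimately have "?T interior_of {p} = {p}" by blast
    then have "openin ?T {p}" using openin_interior_of[of ?T "{p}"] by simp
    then obtain U where U: "open U" "{p} = range cantor \<inter> U" by (auto simp: openin_open)
    obtain w where w: "p = cantor w" using assms by blast
    obtain s where s: "s > 0" "\<And>y. d p y < s \<Longrightarrow> y \<in> U" using open_contains_d_ball[OF U(1)] U(2) by blast
    obtain n where n: "d (a n) 0 < s / 4" using halving_small[OF halving_a, of "s / 4"] s(1) by auto
    define w' where "w' = w(n := \<not> w n)"
    have "d p (cantor w') \<le> 4 * d (a n) 0" unfolding w by (intro cantor_near) (simp add: w'_def)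
    then have "cantor w' \<in> {p}" using n s(2) U(2) by auto
    then have "w' = w" using inj_cantor w by (auto dest: injD)
    then show False unfolding w'_def by (metis fun_upd_same)
  qed
  ultimately show ?thesis using assms by (simp add: nowhere_dense_in_def)
qed

text \<open>The witness is the inclusion of the Cantor set; a countable subset is a countable union
  of nowhere dense singletons.\<close>

lemma small_imp_haar_meager:
  assumes B: "B \<in> sets borel" and count: "\<And>g h. countable {w. cantor w \<in> two_sided_translate g B h}"
  shows "haar_meager B"
proof -
  let ?K = "range cantor"
  interpret K: Submetric UNIV d ?K by unfold_locales auto
  have top: "K.sub.mtopology = top_of_set ?K"
    unfolding K.mtopology_submetric mtopology_eq ..
  have "haar_meager_witness ?K d (\<lambda>x. x) B B"
    unfolding haar_meager_witness_def top
  proof (intro conjI allI)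
    show "Metric_space ?K d" by (rule K.sub.Metric_space_axioms)
    have "compact ?K" using continuous_cantor compact_UNIV_bool_sequences by (rule compact_continuous_image)
    then show "compact_space (top_of_set ?K)" by (simp add: compact_space_subtopology)
    show "continuous_map (top_of_set ?K) euclidean (\<lambda>x. x)" by simp
    fix g h
    let ?A = "{x \<in> ?K. x \<in> two_sided_translate g B h}"
    have "?A = cantor ` {w. cantor w \<in> two_sided_translate g B h}" by auto
    then have "countable ?A" using count[of g h] by simp
    then show "meager_in (top_of_set ?K) ?A"
      unfolding meager_in_def using singleton_nowhere_dense_in_cantor
      by (intro exI[of _ "(\<lambda>p. {p}) ` ?A"]) auto
  qed (use B in auto)
  then show ?thesis by (rule haar_meagerI)
qed

end

section \<open>Choice of the constants\<close>

lemma (in tsi_metric) exists_tsi_scheme: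
  assumes nlc: "\<not> locally_compact_space (euclidean :: 'a topology)"
  shows "\<exists>\<delta> \<epsilon> a q \<gamma>. tsi_scheme d \<delta> \<epsilon> a q \<gamma>"
proof -
  define sep where "sep \<delta> \<epsilon> \<longleftrightarrow> (\<forall>F. finite F \<longrightarrow> (\<exists>g. d g 0 < \<delta> \<and> (\<forall>f\<in>F. \<epsilon> \<le> d g f)))" for \<delta> \<epsilon> :: real
  have "\<exists>\<epsilon>. 0 < \<delta> \<longrightarrow> 0 < \<epsilon> \<and> \<epsilon> \<le> \<delta> \<and> sep \<delta> \<epsilon>" for \<delta>
  proof (cases "0 < \<delta>")
    case True
    then obtain \<epsilon> where "\<epsilon> > 0" "sep \<delta> \<epsilon>" using separated_in_ball[OF nlc] unfolding sep_def by blast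
    moreover have "sep \<delta> (min \<epsilon> \<delta>)"
      unfolding sep_def using \<open>sep \<delta> \<epsilon>\<close> unfolding sep_def by (meson min.coboundedI1)
    ultimately show ?thesis using True by (intro exI[of _ "min \<epsilon> \<delta>"]) auto
  qed auto
  then obtain E where E: "\<And>\<delta>. 0 < \<delta> \<Longrightarrow> 0 < E \<delta>" "\<And>\<delta>. 0 < \<delta> \<Longrightarrow> E \<delta> \<le> \<delta>" "\<And>\<delta>. 0 < \<delta> \<Longrightarrow> sep \<delta> (E \<delta>)"
    by metis
  \<comment> \<open>Separation from the set whose only element is 0 gives arbitrarily small nonzero
    elements.\<close>
  have "\<exists>g. 0 < e \<longrightarrow> 0 < d g 0 \<and> d g 0 < e" for e
  proof (cases "0 < e")
    case True
    then obtain g where "d g 0 < e" "E e \<le> d g 0" using E(3)[OF True] unfolding sep_def by (metis finite.emptyI finite_insert insertI1)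
    then show ?thesis using E(1)[OF True] by (intro exI[of _ g]) linarith
  qed auto
  then obtain A where A: "\<And>e. 0 < e \<Longrightarrow> 0 < d (A e) 0" "\<And>e. 0 < e \<Longrightarrow> d (A e) 0 < e" by metis
  \<comment> \<open>Since \<open>E\<close> and \<open>A\<close> are functions of the radius, a
    recursion for \<delta> alone determines all three sequences.\<close>
  define \<delta> where "\<delta> = rec_nat 1 (\<lambda>_ x. d (A (E x / 4)) 0 / 24)"
  define \<epsilon> where "\<epsilon> n = E (\<delta> n)" for n
  define a where "a n = A (\<epsilon> n / 4)" for n
  have delta_Suc: "\<delta> (Suc n) = d (a n) 0 / 24" for n by (simp add: \<delta>_def \<epsilon>_def a_def)
  have delta_pos: "0 < \<delta> n" for n
  proof (induction n)
    case 0
    then show ?case by (simp add: \<delta>_def)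
  next
    case (Suc n)
    then show ?case unfolding delta_Suc a_def \<epsilon>_def using A(1) E(1) by simp
  qed
  have eps: "0 < \<epsilon> n" "\<epsilon> n \<le> \<delta> n" "sep (\<delta> n) (\<epsilon> n)" for n
    unfolding \<epsilon>_def using E delta_pos by auto
  have a: "0 < d (a n) 0" "d (a n) 0 < \<epsilon> n / 4" for n
    unfolding a_def using A[of "\<epsilon> n / 4"] eps(1)[of n] by auto
  obtain D :: "'a set" where D: "countable D" "\<And>X. open X \<Longrightarrow> X \<noteq> {} \<Longrightarrow> \<exists>y\<in>D. y \<in> X"
    using countable_dense_setE by blast
  have "D \<noteq> {}" using D(2)[of UNIV] by auto
  define q where "q = from_nat_into D"
  have q: "\<exists>i. d (q i) x < e" if e: "0 < e" for e x
  proof -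
    have "{y. d x y < e} \<noteq> {}" using e by (auto intro: exI[of _ x])
    then obtain y where "y \<in> D" "d x y < e" using D(2)[OF open_d_ball] by auto
    moreover obtain i where "q i = y"
      unfolding q_def using from_nat_into_surj[OF D(1) \<open>y \<in> D\<close>] by blast
    ultimately show ?thesis by (auto simp: commute)
  qed
  \<comment> \<open>The finitely many points that the table can yield, whatever \<alpha> is;
    separating these handles all \<alpha> at once.\<close>
  define F where "F \<tau> = q ` snd ` set (snd \<tau>)" for \<tau> :: table
  have F: "finite (F \<tau>)" "table_val \<tau> \<alpha> = Some i \<Longrightarrow> q i \<in> F \<tau>" for \<tau> \<alpha> i
    unfolding F_def using table_val_range by auto
  have "\<exists>\<gamma>. \<forall>k :: nat. d (\<gamma> k) 0 < \<delta> n \<and>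
      (\<forall>j<k. \<forall>x\<in>F (from_nat k). \<forall>y\<in>F (from_nat j). \<epsilon> n \<le> d (\<gamma> k + x) (\<gamma> j + y))" for n
  proof (rule dependent_wellorder_choice[where P = "\<lambda>\<gamma> k g. d g 0 < \<delta> n \<and>
      (\<forall>j<k. \<forall>x\<in>F (from_nat k). \<forall>y\<in>F (from_nat j). \<epsilon> n \<le> d (g + x) (\<gamma> j + y))"])
    fix r :: 'a and f g :: "nat \<Rightarrow> 'a" and k
    assume "\<And>y. y < k \<Longrightarrow> f y = g y"
    then show "(d r 0 < \<delta> n \<and> (\<forall>j<k. \<forall>x\<in>F (from_nat k). \<forall>y\<in>F (from_nat j). \<epsilon> n \<le> d (r + x) (f j + y))) =
        (d r 0 < \<delta> n \<and> (\<forall>j<k. \<forall>x\<in>F (from_nat k). \<forall>y\<in>F (from_nat j). \<epsilon> n \<le> d (r + x) (g j + y)))"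
      by simp
  next
    fix k and f :: "nat \<Rightarrow> 'a"
    \<comment> \<open>By right invariance, separating \<open>g + x\<close> from
      \<open>f j + y\<close> means separating \<open>g\<close> from \<open>f j + y - x\<close>. Only
      finitely many such points arise from the earlier tables.\<close>
    define S where "S = (\<lambda>(j, x, y). f j + y - x) ` (SIGMA j:{..<k}. F (from_nat k) \<times> F (from_nat j))"
    have "finite S" unfolding S_def using F(1) by (intro finite_imageI finite_SigmaI) auto
    then obtain g where g: "d g 0 < \<delta> n" "\<And>s. s \<in> S \<Longrightarrow> \<epsilon> n \<le> d g s"
      using eps(3)[of n] unfolding sep_def by blast
    have "\<epsilon> n \<le> d (g + x) (f j + y)" if "j < k" "x \<in> F (from_nat k)" "y \<in> F (from_nat j)" for j x y
    proof -
      have "f j + y - x \<in> S" unfolding S_def using that by force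
      moreover have "d (g + x) (f j + y) = d g (f j + y - x)"
        using d_right[of g x "f j + y - x"] by (simp del: d_right)
      ultimately show ?thesis using g(2) by simp
    qed
    then show "\<exists>r. d r 0 < \<delta> n \<and> (\<forall>j<k. \<forall>x\<in>F (from_nat k). \<forall>y\<in>F (from_nat j). \<epsilon> n \<le> d (r + x) (f j + y))"
      using g(1) by blast
  qed
  then obtain \<gamma> where \<gamma>: "\<And>n k. d (\<gamma> n k) 0 < \<delta> n"
    "\<And>n k j x y. j < k \<Longrightarrow> x \<in> F (from_nat k) \<Longrightarrow> y \<in> F (from_nat j) \<Longrightarrow> \<epsilon> n \<le> d (\<gamma> n k + x) (\<gamma> n j + y)"
    by metis
  have "tsi_scheme d \<delta> \<epsilon> a q (\<lambda>n \<tau>. \<gamma> n (to_nat \<tau>))"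
  proof (unfold_locales)
    fix \<tau> \<tau>' :: table and \<alpha> i j n
    assume "\<tau> \<noteq> \<tau>'" and val: "table_val \<tau> \<alpha> = Some i" "table_val \<tau>' \<alpha> = Some j"
    then consider "to_nat \<tau>' < to_nat \<tau>" | "to_nat \<tau> < to_nat \<tau>'"
      by (metis from_nat_to_nat linorder_neqE_nat)
    then show "\<epsilon> n \<le> d (\<gamma> n (to_nat \<tau>) + q i) (\<gamma> n (to_nat \<tau>') + q j)"
    proof cases
      case 1
      then show ?thesis using F(2)[OF val(1)] F(2)[OF val(2)] by (intro \<gamma>(2)) simp_all
    next
      case 2
      then show ?thesis
        using F(2)[OF val(1)] F(2)[OF val(2)] by (subst commute) (intro \<gamma>(2), simp_all)
    qed
  qed (use eps a delta_Suc \<gamma>(1) q in \<open>auto intro: less_imp_le\<close>)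
  then show ?thesis by blast
qed

theorem theorem2p7:
  fixes G :: "'a::{polish_space,topological_group_add} itself"
  assumes "\<not> locally_compact_space (euclidean :: 'a topology)"
    and "admits_two_sided_invariant_metric G"
  shows "cof {X :: 'a set. haar_null X} =o cof {X :: 'a set. haar_meager X}
    \<and> cof {X :: 'a set. haar_meager X} =o ctwo ^c natLeq"
proof -
  obtain d :: "'a \<Rightarrow> 'a \<Rightarrow> real" where d: "Metric_space UNIV d" "Metric_space.mtopology UNIV d = euclidean"
    "\<And>x y z. d x y = d (z + x) (z + y) \<and> d x y = d (x + z) (y + z)"
    using assms(2) unfolding admits_two_sided_invariant_metric_def by blast
  interpret tsi_metric d
    using d by (intro tsi_metric.intro tsi_metric_axioms.intro) auto
  obtain \<delta> \<epsilon> a q \<gamma> where "tsi_scheme d \<delta> \<epsilon> a q \<gamma>" using exists_tsi_scheme[OF assms(1)] by blast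
  then interpret tsi_scheme d \<delta> \<epsilon> a q \<gamma> .
  have "cof {X :: 'a set. haar_null X} =o |UNIV :: (nat \<Rightarrow> bool) set|"
    by (rule cof_eq_continuum[OF haar_null_hull small_imp_haar_null])
  moreover have "cof {X :: 'a set. haar_meager X} =o |UNIV :: (nat \<Rightarrow> bool) set|"
    by (rule cof_eq_continuum[OF haar_meager_hull small_imp_haar_meager])
  \<comment> \<open>The cardinal power unfolds to the set of all functions from the naturals to the
    Booleans, so this is an equality of relations.\<close>
  moreover have "ctwo ^c natLeq = |UNIV :: (nat \<Rightarrow> bool) set|"
    unfolding cexp_def ctwo_def Field_natLeq Field_card_of by (simp add: Func_def)
  ultimately show ?thesis
    using ordIso_symmetric ordIso_transitive by metis
qed

end
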